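(* Consider the SEA model (see context) on $\mathcal{X}\subseteq\mathbb{R}^d$ with horizon $T$. Assume there are constants $G,D,L>0$ such that: (i) $\max_{\mathbf{x}\in\mathcal{X}}\|\nabla f_t(\mathbf{x})\|_2\le G$ for every individual function $f_t$, $t\in[T]$; (ii) $\mathbf{0}\in\mathcal{X}$ and $\|\mathbf{x}-\mathbf{y}\|_2\le D$ for all $\mathbf{x},\mathbf{y}\in\mathcal{X}$; (iii) every expected function $F_t$ is $L$-smooth on $\mathcal{X}$, i.e. $\|\nabla F_t(\mathbf{x})-\nabla F_t(\mathbf{y})\|_2\le L\|\mathbf{x}-\mathbf{y}\|_2$ for all $\mathbf x,\mathbf y\in\mathcal X$; (iv) every expected function $F_t$ is convex on $\mathcal{X}$ (convexity of the individual functions is not assumed). Run optimistic follow-the-regularized-leader on linearized losses: with $\ell_t(\mathbf{x})=\langle\nabla f_t(\mathbf{x}_t),\mathbf{x}-\mathbf{x}_t\rangle$, $M_t=\nabla f_{t-1}(\mathbf{x}_{t-1})$ and $M_1=\nabla f_0(\mathbf{x}_0)=\mathbf 0$, $$\mathbf{x}_t=\arg\min_{\mathbf{x}\in\mathcal{X}}\Big\{\sum_{s=1}^{t-1}\ell_s(\mathbf{x})+\langle M_t,\mathbf{x}\rangle+\frac1{\eta_t}\|\mathbf{x}\|_2^2\Big\},\qquad \eta_t=\frac{D^2}{\delta+\sum_{s=1}^{t-1}\eta_s\|\nabla f_s(\mathbf{x}_s)-\nabla f_{s-1}(\mathbf{x}_{s-1})\|_2^2},$$ with $\delta=\sqrt{9D^4L+6D^2G^2}$.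 Then for every fixed $\mathbf{u}\in\mathcal{X}$, $$\mathbb{E}\Big[\sum_{t=1}^T f_t(\mathbf{x}_t)-\sum_{t=1}^T f_t(\mathbf{u})\Big]\le\mathcal{O}\Big(\sqrt{\sigma_{1:T}^2}+\sqrt{\Sigma_{1:T}^2}\Big).$$
   Context: SEA (Stochastically Extended Adversarial) model: $d,T\ge1$, $[T]=\{1,\dots,T\}$, and $\mathcal{X}\subseteq\mathbb{R}^d$ is a nonempty closed convex feasible domain. In each round $t\in[T]$ the learner selects $\mathbf{x}_t\in\mathcal{X}$ based on the previously observed functions $f_1,\dots,f_{t-1}$; nature chooses a distribution $\mathfrak{D}_t$ over differentiable functions $\mathcal{X}\to\mathbb{R}$ (possibly random, depending on the past); then the individual (random) function $f_t$ is sampled from $\mathfrak{D}_t$ (i.e. conditionally on the past and on $\mathfrak{D}_t$, $f_t$ has law $\mathfrak{D}_t$), the learner suffers $f_t(\mathbf{x}_t)$ and observes $f_t$. The (conditional) expected function is $F_t(\mathbf{x})=\mathbb{E}_{f_t\sim\mathfrak{D}_t}[f_t(\mathbf{x})]$, and differentiation and expectation may be interchanged: $\nabla F_t(\mathbf{x})=\mathbb{E}_{f_t\sim\mathfrak{D}_t}[\nabla f_t(\mathbf{x})]$. Define $$\sigma_t^2=\sup_{\mathbf{x}\in\mathcal{X}}\mathbb{E}_{f_t\sim\mathfrak{D}_t}\big[\|\nabla f_t(\mathbf{x})-\nabla F_t(\mathbf{x})\|_2^2\big],\quad \sigma_{1:T}^2=\mathbb{E}\Big[\sum_{t=1}^T\sigma_t^2\Big],\quad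 \Sigma_{1:T}^2=\mathbb{E}\Big[\sum_{t=1}^T\sup_{\mathbf{x}\in\mathcal{X}}\|\nabla F_t(\mathbf{x})-\nabla F_{t-1}(\mathbf{x})\|_2^2\Big],$$ with $\nabla F_0\equiv\mathbf 0$. The $\mathcal{O}$-notation means: bounded by $C\,(1+\sqrt{\sigma_{1:T}^2}+\sqrt{\Sigma_{1:T}^2})$ with $C$ depending only on $D,G,L$. *)

theory Defs
  imports "HOL-Probability.Probability"
begin

text \<open>
  Individual functions on the domain \<open>X\<close> are represented by total functions \<open>'a \<Rightarrow> real\<close> (values
  outside \<open>X\<close> play no role); \<open>N\<close> is the measurable space of the individual functions that nature
  may use. Gradients are taken within \<open>X\<close>. If \<open>X\<close> has empty interior these are not unique, so
  the model carries a map \<open>grad\<close> assigning to each individual function one of its gradient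
  fields (for instance the ambient one, if the function is differentiable around \<open>X\<close>).
\<close>

definition exp_fun :: "('a \<Rightarrow> real) measure \<Rightarrow> 'a \<Rightarrow> real" where
  "exp_fun P x = (\<integral>h. h x \<partial>P)"

definition exp_grad ::
  "(('a \<Rightarrow> real) \<Rightarrow> 'a \<Rightarrow> 'a::euclidean_space) \<Rightarrow> ('a \<Rightarrow> real) measure \<Rightarrow> 'a \<Rightarrow> 'a" where
  "exp_grad grad P x = (\<integral>h. grad h x \<partial>P)"

definition grad_variance ::
  "(('a \<Rightarrow> real) \<Rightarrow> 'a \<Rightarrow> 'a::euclidean_space) \<Rightarrow> 'a set \<Rightarrow> ('a \<Rightarrow> real) measure \<Rightarrow> real" where
  "grad_variance grad X P = (SUP x\<in>X. \<integral>h. (norm (grad h x - exp_grad grad P x))\<^sup>2 \<partial>P)"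

text \<open>Round 0 is a convention only: the gradient of the expected function of round 0 is zero.\<close>

definition exp_grad_seq ::
  "(('a \<Rightarrow> real) \<Rightarrow> 'a \<Rightarrow> 'a::euclidean_space) \<Rightarrow> (nat \<Rightarrow> 'w \<Rightarrow> ('a \<Rightarrow> real) measure)
    \<Rightarrow> nat \<Rightarrow> 'w \<Rightarrow> 'a \<Rightarrow> 'a" where
  "exp_grad_seq grad Dist t \<omega> x = (if t = 0 then 0 else exp_grad grad (Dist t \<omega>) x)"

definition grad_variation ::
  "(('a \<Rightarrow> real) \<Rightarrow> 'a \<Rightarrow> 'a::euclidean_space) \<Rightarrow> 'a set
    \<Rightarrow> (nat \<Rightarrow> 'w \<Rightarrow> ('a \<Rightarrow> real) measure) \<Rightarrow> nat \<Rightarrow> 'w \<Rightarrow> real" where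
  "grad_variation grad X Dist t \<omega> =
     (SUP x\<in>X. (norm (exp_grad_seq grad Dist t \<omega> x - exp_grad_seq grad Dist (t - 1) \<omega> x))\<^sup>2)"

text \<open>
  \<open>H t\<close> is the information on which \<open>f t\<close> is conditioned: it contains the past functions, the
  past distributions and the distribution \<open>Dist t\<close> (and possibly further randomness of nature).
  The joint measurability of evaluation and gradient evaluation makes \<open>f t (x t)\<close> and its gradient
  random variables for random \<open>x t\<close>; the last two assumptions make the expectations in
  the definitions of \<open>sigma_sq_total\<close> and \<open>Sigma_sq_total\<close> below meaningful.
\<close>

locale sea_model = prob_space M
  for M :: "'w measure"
    and X :: "'a::euclidean_space set"
    and T :: nat
    and N :: "('a \<Rightarrow> real) measure"
    and grad :: "('a \<Rightarrow> real) \<Rightarrow> 'a \<Rightarrow> 'a"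
    and H :: "nat \<Rightarrow> 'w measure"
    and Dist :: "nat \<Rightarrow> 'w \<Rightarrow> ('a \<Rightarrow> real) measure"
    and f :: "nat \<Rightarrow> 'w \<Rightarrow> 'a \<Rightarrow> real" +
  assumes horizon: "T \<ge> 1"
    and domain: "X \<noteq> {}" "closed X" "convex X"
    and differentiable:
      "\<And>h x. h \<in> space N \<Longrightarrow> x \<in> X \<Longrightarrow> (h has_derivative (\<lambda>v. grad h x \<bullet> v)) (at x within X)"
    and eval_measurable:
      "(\<lambda>(h, x). h x) \<in> borel_measurable (N \<Otimes>\<^sub>M restrict_space borel X)"
    and grad_measurable:
      "(\<lambda>(h, x). grad h x) \<in> borel_measurable (N \<Otimes>\<^sub>M restrict_space borel X)"
    and history: "\<And>t. t \<in> {1..T} \<Longrightarrow> subalgebra M (H t)"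
    and past_functions: "\<And>s t. t \<in> {1..T} \<Longrightarrow> s \<in> {1..<t} \<Longrightarrow> f s \<in> H t \<rightarrow>\<^sub>M N"
    and distributions: "\<And>s t. t \<in> {1..T} \<Longrightarrow> s \<in> {1..t} \<Longrightarrow> Dist s \<in> H t \<rightarrow>\<^sub>M prob_algebra N"
    and sampled: "\<And>t. t \<in> {1..T} \<Longrightarrow> f t \<in> M \<rightarrow>\<^sub>M N"
    and conditional_law:
      "\<And>t A. t \<in> {1..T} \<Longrightarrow> A \<in> sets N \<Longrightarrow>
         AE \<omega> in M. real_cond_exp M (H t) (\<lambda>\<omega>'. indicator A (f t \<omega>')) \<omega> = measure (Dist t \<omega>) A"
    and exp_fun_integrable:
      "\<And>t \<omega> x. t \<in> {1..T} \<Longrightarrow> \<omega> \<in> space M \<Longrightarrow> x \<in> X \<Longrightarrow> integrable (Dist t \<omega>) (\<lambda>h. h x)"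
    and interchange:
      "\<And>t \<omega> x. t \<in> {1..T} \<Longrightarrow> \<omega> \<in> space M \<Longrightarrow> x \<in> X \<Longrightarrow>
         (exp_fun (Dist t \<omega>) has_derivative (\<lambda>v. exp_grad grad (Dist t \<omega>) x \<bullet> v)) (at x within X)"
    and variance_measurable:
      "\<And>t. t \<in> {1..T} \<Longrightarrow> (\<lambda>\<omega>. grad_variance grad X (Dist t \<omega>)) \<in> borel_measurable M"
    and variation_measurable:
      "\<And>t. t \<in> {1..T} \<Longrightarrow> grad_variation grad X Dist t \<in> borel_measurable M"

definition sigma_sq_total ::
  "'w measure \<Rightarrow> (('a \<Rightarrow> real) \<Rightarrow> 'a \<Rightarrow> 'a::euclidean_space) \<Rightarrow> 'a set
    \<Rightarrow> (nat \<Rightarrow> 'w \<Rightarrow> ('a \<Rightarrow> real) measure) \<Rightarrow> nat \<Rightarrow> real" where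
  "sigma_sq_total M grad X Dist T = (\<integral>\<omega>. (\<Sum>t=1..T. grad_variance grad X (Dist t \<omega>)) \<partial>M)"

definition Sigma_sq_total ::
  "'w measure \<Rightarrow> (('a \<Rightarrow> real) \<Rightarrow> 'a \<Rightarrow> 'a::euclidean_space) \<Rightarrow> 'a set
    \<Rightarrow> (nat \<Rightarrow> 'w \<Rightarrow> ('a \<Rightarrow> real) measure) \<Rightarrow> nat \<Rightarrow> real" where
  "Sigma_sq_total M grad X Dist T = (\<integral>\<omega>. (\<Sum>t=1..T. grad_variation grad X Dist t \<omega>) \<partial>M)"

text \<open>Observed gradients, with the convention that the one of round 0 is zero.\<close>

definition obs_grad ::
  "(('a \<Rightarrow> real) \<Rightarrow> 'a \<Rightarrow> 'a::euclidean_space) \<Rightarrow> (nat \<Rightarrow> 'w \<Rightarrow> 'a \<Rightarrow> real)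
    \<Rightarrow> (nat \<Rightarrow> 'w \<Rightarrow> 'a) \<Rightarrow> nat \<Rightarrow> 'w \<Rightarrow> 'a" where
  "obs_grad grad f x t \<omega> = (if t = 0 then 0 else grad (f t \<omega>) (x t \<omega>))"

definition oftrl_delta :: "real \<Rightarrow> real \<Rightarrow> real \<Rightarrow> real" where
  "oftrl_delta D G L = sqrt (9 * D^4 * L + 6 * D\<^sup>2 * G\<^sup>2)"

definition oftrl_step ::
  "real \<Rightarrow> real \<Rightarrow> (nat \<Rightarrow> 'a::euclidean_space) \<Rightarrow> (nat \<Rightarrow> real) \<Rightarrow> nat \<Rightarrow> bool" where
  "oftrl_step D \<delta> g \<eta> t \<longleftrightarrow>
     \<eta> t = D\<^sup>2 / (\<delta> + (\<Sum>s\<in>{1..<t}. \<eta> s * (norm (g s - g (s - 1)))\<^sup>2))"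

definition oftrl_objective ::
  "(nat \<Rightarrow> 'a::euclidean_space) \<Rightarrow> (nat \<Rightarrow> real) \<Rightarrow> (nat \<Rightarrow> 'a) \<Rightarrow> nat \<Rightarrow> 'a \<Rightarrow> real" where
  "oftrl_objective g \<eta> x t y =
     (\<Sum>s\<in>{1..<t}. g s \<bullet> (y - x s)) + g (t - 1) \<bullet> y + 1 / \<eta> t * (norm y)\<^sup>2"

text \<open>
  The constant hidden in the \<open>O\<close>-notation. It must depend on \<open>D\<close>, \<open>G\<close>, \<open>L\<close> only, in particular
  not on the dimension or on the probability space. These are given by type variables, over which
  an existential quantifier inside a formula cannot be made uniform; a closed expression in
  \<open>D\<close>, \<open>G\<close>, \<open>L\<close> expresses the independence. The numerical factor is not optimised.
\<close>

definition oftrl_const :: "real \<Rightarrow> real \<Rightarrow> real \<Rightarrow> real" where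
  "oftrl_const D G L =
     20 * (oftrl_delta D G L + D^4 * L\<^sup>2 / oftrl_delta D G L + D)"

end

theory Submission
  imports Defs
begin

text \<open>
  The potential \<open>\<Sum>s<t. g\<^sub>s \<bullet> x\<^sub>t + (norm x\<^sub>t)\<^sup>2 / \<eta>\<^sub>t\<close> telescopes over the rounds. Strong convexity of the
  objectives gives a linearised regret of at most
  \<open>D\<^sup>2 / \<eta>\<^sub>T + (\<Sum>t. \<eta>\<^sub>t \<Delta>\<^sub>t) / 2\<close> minus the squared moves \<open>(norm (x\<^sub>t\<^sub>+\<^sub>1 - x\<^sub>t))\<^sup>2 / (2 \<eta>\<^sub>t)\<close>, where \<open>\<Delta>\<^sub>t\<close> is the
  squared distance of consecutive observed gradients. The step sizes turn the first two terms into
  \<open>\<delta> + O(D) sqrt (\<Sum>t. \<Delta>\<^sub>t)\<close>. Each \<open>\<Delta>\<^sub>t\<close> splits into sampling noise, gradient variation and, by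
  smoothness, \<open>L\<^sup>2\<close> times a squared move; since \<open>1 / \<eta>\<^sub>t \<ge> \<delta> / D\<^sup>2\<close>, the moves are absorbed by the negative
  terms at the cost of \<open>O(D\<^sup>4 L\<^sup>2 / \<delta>)\<close>. Expectations are taken last: \<open>x\<^sub>t\<close> is a projection onto \<open>X\<close> of a
  function of the past, so conditioning on the history replaces \<open>f\<^sub>t\<close> by the distribution it is drawn
  from, which yields convexity (for the regret) and the variance (for the noise), and Jensen's
  inequality moves the expectation under the square roots.
\<close>

section \<open>Optimistic FTRL on a fixed sequence of gradients\<close>

text \<open>Completing the square turns the objective into \<open>c\<close> times the squared
  distance to \<open>- (1 / (2 * c)) *\<^sub>R a\<close>, up to a constant. A minimiser is thus a
  projection, which later makes the iterates measurable, and it has the quadratic growth that strong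
  convexity provides.\<close>

lemma is_arg_min_quadratic:
  fixes a :: "'a::euclidean_space"
  assumes X: "closed X" "convex X" and c: "c > 0"
    and min: "is_arg_min (\<lambda>y. a \<bullet> y + c * (norm y)\<^sup>2 + b) (\<lambda>y. y \<in> X) x"
  shows "x = closest_point X (- (1 / (2 * c)) *\<^sub>R a)"
    and "y \<in> X \<Longrightarrow> a \<bullet> x + c * (norm x)\<^sup>2 + c * (norm (y - x))\<^sup>2 \<le> a \<bullet> y + c * (norm y)\<^sup>2"
proof -
  define p where "p = - (1 / (2 * c)) *\<^sub>R a"
  have a: "a = - (2 * c) *\<^sub>R p"
    using c by (simp add: p_def)
  have square: "a \<bullet> y + c * (norm y)\<^sup>2 = c * (dist p y)\<^sup>2 - c * (p \<bullet> p)" for y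
    unfolding a dist_norm power2_norm_eq_inner
    by (simp add: algebra_simps inner_commute)
  have x: "x \<in> X" and le: "\<forall>z\<in>X. dist p x \<le> dist p z"
  proof -
    show "x \<in> X" using min by (simp add: is_arg_min_def)
    show "\<forall>z\<in>X. dist p x \<le> dist p z"
    proof
      fix z assume "z \<in> X"
      then have "c * (dist p x)\<^sup>2 \<le> c * (dist p z)\<^sup>2"
        using min square[of x] square[of z] by (auto simp: is_arg_min_def not_less)
      then show "dist p x \<le> dist p z"
        using c by (simp add: power2_le_iff_abs_le)
    qed
  qed
  show "x = closest_point X (- (1 / (2 * c)) *\<^sub>R a)"
    using closest_point_unique[OF X(2,1) x le] by (simp add: p_def)
  assume "y \<in> X"
  \<comment> \<open>Variational inequality of the projection \<open>x\<close> of \<open>p\<close>.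
    Inserted into the law of cosines below, it produces the growth term.\<close>
  then have "c * ((p - x) \<bullet> (y - x)) \<le> 0"
    using any_closest_point_dot[OF X(2,1) x _ le] c by (simp add: mult_le_0_iff)
  moreover have "(dist p y)\<^sup>2 = (dist p x)\<^sup>2 + (norm (y - x))\<^sup>2 - 2 * ((p - x) \<bullet> (y - x))"
    unfolding dist_norm power2_norm_eq_inner by (simp add: algebra_simps inner_commute)
  then have "c * (dist p y)\<^sup>2 = c * (dist p x)\<^sup>2 + c * (norm (y - x))\<^sup>2 - 2 * (c * ((p - x) \<bullet> (y - x)))"
    by (simp only: right_diff_distrib distrib_left)
  ultimately show "a \<bullet> x + c * (norm x)\<^sup>2 + c * (norm (y - x))\<^sup>2 \<le> a \<bullet> y + c * (norm y)\<^sup>2"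
    unfolding square by linarith
qed

text \<open>Isolates the linear and the quadratic part, so that \<open>is_arg_min_quadratic\<close>
  applies with \<open>c = 1 / \<eta> t\<close>. The remaining summand is constant in
  \<open>y\<close> and does not move the minimiser.\<close>

lemma oftrl_objective_alt:
  "oftrl_objective g \<eta> x t = (\<lambda>y. ((\<Sum>s\<in>{1..<t}. g s) + g (t - 1)) \<bullet> y + 1 / \<eta> t * (norm y)\<^sup>2
     + - (\<Sum>s\<in>{1..<t}. g s \<bullet> x s))"
  by (rule ext) (simp add: oftrl_objective_def inner_diff_right sum_subtractf inner_sum_left inner_add_left)

text \<open>Young's inequality with weight \<open>e\<close>, from the nonnegativity of a square and
  Cauchy-Schwarz.\<close>

lemma inner_le_scaled_squares:
  fixes v w :: "'a::euclidean_space"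
  assumes "e > 0"
  shows "\<bar>v \<bullet> w\<bar> \<le> e * (norm v)\<^sup>2 / 2 + (norm w)\<^sup>2 / (2 * e)"
proof -
  have "0 \<le> (e * norm v - norm w)\<^sup>2 / (2 * e)"
    using assms by simp
  also have "\<dots> = e * (norm v)\<^sup>2 / 2 + (norm w)\<^sup>2 / (2 * e) - norm v * norm w"
    using assms by (simp add: field_simps power2_eq_square)
  finally show ?thesis
    using Cauchy_Schwarz_ineq2[of v w] by linarith
qed

text \<open>The comparator \<open>u\<close> plays the role of the missing iterate of round \<open>T + 1\<close>.\<close>

lemma oftrl_regret:
  fixes g x :: "nat \<Rightarrow> 'a::euclidean_space"
  assumes X: "closed X" "convex X" and T: "T \<ge> 1" and u: "u \<in> X" and g0: "g 0 = 0"
    and \<eta>_pos: "\<And>t. t \<in> {1..T} \<Longrightarrow> \<eta> t > 0"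
    and \<eta>_mono: "\<And>t. t \<in> {1..<T} \<Longrightarrow> \<eta> (Suc t) \<le> \<eta> t"
    and min: "\<And>t. t \<in> {1..T} \<Longrightarrow> is_arg_min (oftrl_objective g \<eta> x t) (\<lambda>y. y \<in> X) (x t)"
  shows "(\<Sum>t=1..T. g t \<bullet> (x t - u)) \<le> (norm u)\<^sup>2 / \<eta> T
     + (\<Sum>t=1..T. \<eta> t * (norm (g t - g (t - 1)))\<^sup>2) / 2
     - (\<Sum>t\<in>{1..<T}. (norm (x (Suc t) - x t))\<^sup>2 / (2 * \<eta> t))"
proof -
  define \<Gamma> where "\<Gamma> n = (\<Sum>s\<in>{1..<n}. g s)" for n
  define gap where "gap t = \<eta> t * (norm (g t - g (t - 1)))\<^sup>2 / 2" for t
  define move where "move t = (norm (x (Suc t) - x t))\<^sup>2 / (2 * \<eta> t)" for t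
  have \<Gamma>_Suc: "\<Gamma> (Suc t) = \<Gamma> t + g t" if "t \<ge> 1" for t
    using that by (simp add: \<Gamma>_def)
  \<comment> \<open>Growth of the objective of round \<open>t\<close>, compared at \<open>y\<close>.
    Trading the prediction \<open>g (t - 1)\<close> for \<open>g t\<close> costs an inner product;
    Young's inequality with weight \<open>\<eta> t\<close> pays for it with \<open>gap t\<close> and
    half of the growth term.\<close>
  have step: "\<Gamma> t \<bullet> x t + (norm (x t))\<^sup>2 / \<eta> t + g t \<bullet> x t - gap t + (norm (y - x t))\<^sup>2 / (2 * \<eta> t)
      \<le> \<Gamma> (Suc t) \<bullet> y + (norm y)\<^sup>2 / \<eta> t"
    if t: "t \<in> {1..T}" and y: "y \<in> X" for t y
  proof -
    have pos: "1 / \<eta> t > 0" using \<eta>_pos[OF t] by simp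
    have "(\<Gamma> t + g (t - 1)) \<bullet> x t + 1 / \<eta> t * (norm (x t))\<^sup>2 + 1 / \<eta> t * (norm (y - x t))\<^sup>2
        \<le> (\<Gamma> t + g (t - 1)) \<bullet> y + 1 / \<eta> t * (norm y)\<^sup>2"
      using is_arg_min_quadratic(2)[OF X pos min[OF t, unfolded oftrl_objective_alt] y]
      by (simp add: \<Gamma>_def)
    moreover have "- gap t - (norm (y - x t))\<^sup>2 / (2 * \<eta> t) \<le> (g t - g (t - 1)) \<bullet> (y - x t)"
      using inner_le_scaled_squares[OF \<eta>_pos[OF t], of "g t - g (t - 1)" "y - x t"]
      unfolding gap_def by linarith
    moreover have "1 / \<eta> t * (norm (y - x t))\<^sup>2 = 2 * ((norm (y - x t))\<^sup>2 / (2 * \<eta> t))"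
      by simp
    moreover have "\<Gamma> (Suc t) = \<Gamma> t + g t" using t by (simp add: \<Gamma>_Suc)
    ultimately show ?thesis
      by (simp add: inner_add_left inner_diff_left inner_diff_right)
  qed
  have xX: "x t \<in> X" if "t \<in> {1..T}" for t
    using min[OF that] by (simp add: is_arg_min_def)
  \<comment> \<open>The effective base case is \<open>n = 1\<close>, where both sums are empty and
    the regulariser is nonnegative.\<close>
  have ind: "n \<in> {1..T} \<Longrightarrow> (\<Sum>t\<in>{1..<n}. g t \<bullet> x t - gap t + move t) \<le> \<Gamma> n \<bullet> x n + (norm (x n))\<^sup>2 / \<eta> n" for n
  proof (induction n)
    case (Suc n)
    show ?case
    proof (cases "n = 0")
      case True
      then show ?thesis using \<eta>_pos[of 1] T by (simp add: \<Gamma>_def)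
    next
      case False
      then have n: "n \<in> {1..T}" "n \<in> {1..<T}" using Suc.prems by auto
      have "(\<Sum>t\<in>{1..<Suc n}. g t \<bullet> x t - gap t + move t)
         \<le> \<Gamma> n \<bullet> x n + (norm (x n))\<^sup>2 / \<eta> n + g n \<bullet> x n - gap n + move n"
        using Suc.IH[OF n(1)] False by simp
      also have "\<dots> \<le> \<Gamma> (Suc n) \<bullet> x (Suc n) + (norm (x (Suc n)))\<^sup>2 / \<eta> n"
        using step[OF n(1) xX[OF Suc.prems]] by (simp add: move_def)
      \<comment> \<open>The step sizes do not increase, so the regulariser only grows from one round
        to the next; this lets the potential telescope.\<close>
      also have "(norm (x (Suc n)))\<^sup>2 / \<eta> n \<le> (norm (x (Suc n)))\<^sup>2 / \<eta> (Suc n)"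
        using \<eta>_mono[OF n(2)] \<eta>_pos[OF Suc.prems] by (simp add: frac_le)
      finally show ?thesis by simp
    qed
  qed simp
  have T': "T \<in> {1..T}" using T by simp
  have split: "(\<Sum>t=1..T. a t) = (\<Sum>t\<in>{1..<T}. a t) + a T" for a :: "nat \<Rightarrow> real"
  proof -
    have "{1..T} = insert T {1..<T}" using T by auto
    then show ?thesis by simp
  qed
  \<comment> \<open>The last round earns no credit for a move: a nonnegative term is added on the
    right so that \<open>step\<close> applies with \<open>y = u\<close>.\<close>
  have "(\<Sum>t\<in>{1..<T}. g t \<bullet> x t - gap t + move t) + g T \<bullet> x T - gap T
      \<le> \<Gamma> T \<bullet> x T + (norm (x T))\<^sup>2 / \<eta> T + g T \<bullet> x T - gap T + (norm (u - x T))\<^sup>2 / (2 * \<eta> T)"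
    using ind[OF T'] \<eta>_pos[OF T'] by (simp add: add_increasing2)
  also have "\<dots> \<le> \<Gamma> (Suc T) \<bullet> u + (norm u)\<^sup>2 / \<eta> T"
    by (rule step[OF T' u])
  also have "\<Gamma> (Suc T) \<bullet> u = (\<Sum>t=1..T. g t \<bullet> u)"
    by (simp add: \<Gamma>_def inner_sum_left atLeastLessThanSuc_atLeastAtMost)
  finally have "(\<Sum>t\<in>{1..<T}. g t \<bullet> x t - gap t + move t) + g T \<bullet> x T - gap T
      \<le> (\<Sum>t=1..T. g t \<bullet> u) + (norm u)\<^sup>2 / \<eta> T" .
  moreover have "(\<Sum>t=1..T. \<eta> t * (norm (g t - g (t - 1)))\<^sup>2) / 2 = (\<Sum>t=1..T. gap t)"
    by (simp add: gap_def sum_divide_distrib)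
  ultimately show ?thesis
    unfolding move_def[symmetric] split
    by (simp add: sum.distrib sum_subtractf inner_diff_right add_divide_distrib)
qed

text \<open>
  With \<open>S\<^sub>t = D\<^sup>2 / \<eta>\<^sub>t\<close> the recursion reads \<open>S\<^sub>t\<^sub>+\<^sub>1 = S\<^sub>t + D\<^sup>2 \<Delta>\<^sub>t / S\<^sub>t\<close>. Squaring gives an increment of
  \<open>2 D\<^sup>2 \<Delta>\<^sub>t\<close> plus a remainder, which the lower bound on \<open>\<delta>\<close> makes at most \<open>2 / 3 D\<^sup>2 \<Delta>\<^sub>t\<close>.
\<close>

lemma step_size_growth:
  fixes \<eta> \<Delta> :: "nat \<Rightarrow> real"
  assumes D: "D > 0" and \<delta>: "\<delta> > 0" "6 * D\<^sup>2 * G\<^sup>2 \<le> \<delta>\<^sup>2"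
    and \<Delta>: "\<And>t. t \<in> {1..T} \<Longrightarrow> 0 \<le> \<Delta> t \<and> \<Delta> t \<le> 4 * G\<^sup>2"
    and \<eta>: "\<And>t. t \<in> {1..T} \<Longrightarrow> \<eta> t = D\<^sup>2 / (\<delta> + (\<Sum>s\<in>{1..<t}. \<eta> s * \<Delta> s))"
  shows "t \<in> {1..T} \<Longrightarrow> \<eta> t > 0"
    and "t \<in> {1..<T} \<Longrightarrow> \<eta> (Suc t) \<le> \<eta> t"
    and "t \<in> {1..T} \<Longrightarrow> \<delta> / D\<^sup>2 \<le> 1 / \<eta> t"
    and "\<delta> + (\<Sum>s=1..T. \<eta> s * \<Delta> s) \<le> \<delta> + 5 / 3 * D * sqrt (\<Sum>s=1..T. \<Delta> s)"
proof -
  define S where "S n = \<delta> + (\<Sum>s\<in>{1..<n}. \<eta> s * \<Delta> s)" for n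
  have S_Suc: "S (Suc n) = S n + \<eta> n * \<Delta> n" if "n \<ge> 1" for n
    using that by (simp add: S_def)
  have \<eta>_S: "\<eta> t = D\<^sup>2 / S t" if "t \<in> {1..T}" for t
    using \<eta>[OF that] by (simp add: S_def)
  \<comment> \<open>\<open>S n \<ge> \<delta>\<close> makes \<open>\<eta> n\<close> nonnegative,
    which in turn keeps \<open>S (Suc n)\<close> above \<open>\<delta>\<close>; positivity of the
    step sizes is obtained from this induction.\<close>
  have S_ge: "n \<le> Suc T \<Longrightarrow> \<delta> \<le> S n" for n
  proof (induction n)
    case 0 then show ?case by (simp add: S_def)
  next
    case (Suc n)
    show ?case
    proof (cases "n = 0")
      case True then show ?thesis by (simp add: S_def)
    next
      case False
      then have n: "n \<in> {1..T}" using Suc.prems by auto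
      have "\<delta> \<le> S n" using Suc by simp
      moreover from this have "0 \<le> \<eta> n * \<Delta> n"
        using \<Delta>[OF n] \<delta> by (simp add: \<eta>_S[OF n])
      ultimately show ?thesis using False by (simp add: S_Suc)
    qed
  qed
  show pos: "\<eta> t > 0" if "t \<in> {1..T}" for t
    using S_ge[of t] that D \<delta> by (simp add: \<eta>_S[OF that])
  show "\<delta> / D\<^sup>2 \<le> 1 / \<eta> t" if "t \<in> {1..T}" for t
    using S_ge[of t] that D by (simp add: \<eta>_S[OF that] divide_right_mono)
  show "\<eta> (Suc t) \<le> \<eta> t" if t: "t \<in> {1..<T}" for t
  proof -
    have t': "t \<in> {1..T}" "Suc t \<in> {1..T}" using t by auto
    have "S t \<le> S (Suc t)" using S_Suc[of t] pos[OF t'(1)] \<Delta>[OF t'(1)] t by simp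
    then show ?thesis
      using S_ge[of t] t \<delta> by (simp add: \<eta>_S[OF t'(1)] \<eta>_S[OF t'(2)] frac_le)
  qed
  have sq: "n \<le> Suc T \<Longrightarrow> (S n)\<^sup>2 \<le> \<delta>\<^sup>2 + 8 / 3 * D\<^sup>2 * (\<Sum>s\<in>{1..<n}. \<Delta> s)" for n
  proof (induction n)
    case 0 then show ?case by (simp add: S_def)
  next
    case (Suc n)
    show ?case
    proof (cases "n = 0")
      case True then show ?thesis by (simp add: S_def)
    next
      case False
      then have n: "n \<in> {1..T}" using Suc.prems by auto
      have Sn: "\<delta> \<le> S n" using S_ge n by simp
      then have Sn_pos: "S n > 0" using \<delta> by simp
      have "\<delta>\<^sup>2 \<le> (S n)\<^sup>2" using Sn \<delta> by (simp add: power_mono)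
      then have "6 * D\<^sup>2 * G\<^sup>2 \<le> (S n)\<^sup>2" using \<delta> by simp
      moreover have "D\<^sup>2 * \<Delta> n \<le> D\<^sup>2 * (4 * G\<^sup>2)" using \<Delta>[OF n] by (intro mult_left_mono) auto
      \<comment> \<open>The factor is \<open>4 / 6\<close>, from
        \<open>\<Delta> n \<le> 4 * G^2\<close> and
        \<open>6 * D^2 * G^2 \<le> \<delta>^2\<close>.\<close>
      ultimately have "D\<^sup>2 * \<Delta> n \<le> 2 / 3 * (S n)\<^sup>2" by simp
      then have "(D\<^sup>2 * \<Delta> n) * (D\<^sup>2 * \<Delta> n) \<le> (D\<^sup>2 * \<Delta> n) * (2 / 3 * (S n)\<^sup>2)"
        using \<Delta>[OF n] by (intro mult_left_mono) auto
      then have extra: "(\<eta> n * \<Delta> n)\<^sup>2 \<le> 2 / 3 * D\<^sup>2 * \<Delta> n"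
        using Sn_pos by (simp add: \<eta>_S[OF n] field_simps power2_eq_square)
      have "(S (Suc n))\<^sup>2 = (S n)\<^sup>2 + 2 * (S n * (\<eta> n * \<Delta> n)) + (\<eta> n * \<Delta> n)\<^sup>2"
        using False by (simp add: S_Suc power2_eq_square algebra_simps)
      also have "S n * (\<eta> n * \<Delta> n) = D\<^sup>2 * \<Delta> n"
        using Sn_pos by (simp add: \<eta>_S[OF n])
      finally have "(S (Suc n))\<^sup>2 \<le> (S n)\<^sup>2 + 8 / 3 * D\<^sup>2 * \<Delta> n" using extra by linarith
      then show ?thesis using Suc False by (simp add: algebra_simps add_divide_distrib)
    qed
  qed
  let ?\<Sigma> = "\<Sum>s=1..T. \<Delta> s"
  have \<Sigma>: "?\<Sigma> \<ge> 0" using \<Delta> by (intro sum_nonneg) auto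
  have "(S (Suc T))\<^sup>2 \<le> \<delta>\<^sup>2 + 8 / 3 * D\<^sup>2 * ?\<Sigma>"
    using sq[of "Suc T"] by (simp add: atLeastLessThanSuc_atLeastAtMost)
  \<comment> \<open>\<open>8 / 3\<close> is rounded up to \<open>25 / 9 = (5 / 3)^2\<close> and a
    cross term is added, to obtain a perfect square.\<close>
  also have "\<dots> \<le> \<delta>\<^sup>2 + 25 / 9 * D\<^sup>2 * ?\<Sigma> + 2 * \<delta> * (5 / 3 * D * sqrt ?\<Sigma>)"
  proof -
    have "8 / 3 * (D\<^sup>2 * ?\<Sigma>) \<le> 25 / 9 * (D\<^sup>2 * ?\<Sigma>)"
      using \<Sigma> by (intro mult_right_mono) auto
    moreover have "0 \<le> 2 * \<delta> * (5 / 3 * D * sqrt ?\<Sigma>)" using \<delta> D \<Sigma> by simp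
    ultimately show ?thesis by linarith
  qed
  also have "\<dots> = (\<delta> + 5 / 3 * D * sqrt ?\<Sigma>)\<^sup>2"
    using \<Sigma> by (simp add: power2_sum power_mult_distrib power_divide)
  finally have "S (Suc T) \<le> \<delta> + 5 / 3 * D * sqrt ?\<Sigma>"
    by (rule power2_le_imp_le) (use \<delta> D \<Sigma> in simp)
  then show "\<delta> + (\<Sum>s=1..T. \<eta> s * \<Delta> s) \<le> \<delta> + 5 / 3 * D * sqrt ?\<Sigma>"
    by (simp add: S_def atLeastLessThanSuc_atLeastAtMost)
qed

section \<open>Conditional laws\<close>

text \<open>The parameter of the integrand is moved into the measure: pushing \<open>L a\<close>
  forward along \<open>Pair a\<close> leaves the integral of one fixed function on the product, over
  a kernel that depends measurably on \<open>a\<close>.\<close>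

lemma integral_measurable_kernel:
  fixes \<phi> :: "'a \<Rightarrow> 'b \<Rightarrow> 'c::{banach, second_countable_topology}"
  assumes \<phi>: "(\<lambda>(a, b). \<phi> a b) \<in> borel_measurable (M \<Otimes>\<^sub>M N)"
    and L: "L \<in> M \<rightarrow>\<^sub>M subprob_algebra N"
  shows "(\<lambda>a. \<integral>b. \<phi> a b \<partial>L a) \<in> borel_measurable M"
proof -
  have "(\<lambda>a. \<integral>p. (\<lambda>(a, b). \<phi> a b) p \<partial>distr (L a) (M \<Otimes>\<^sub>M N) (Pair a)) \<in> borel_measurable M"
    by (rule measurable_compose[OF _ integral_measurable_subprob_algebra[OF \<phi>]])
      (rule measurable_distr2[OF _ L], simp)
  also have "?this \<longleftrightarrow> ?thesis"
  proof (rule measurable_cong)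
    fix a assume a: "a \<in> space M"
    have "Pair a \<in> L a \<rightarrow>\<^sub>M M \<Otimes>\<^sub>M N"
      using measurable_Pair1'[OF a] measurable_cong_sets[OF sets_kernel[OF L a] refl] by blast
    then show "(\<integral>p. (\<lambda>(a, b). \<phi> a b) p \<partial>distr (L a) (M \<Otimes>\<^sub>M N) (Pair a)) = (\<integral>b. \<phi> a b \<partial>L a)"
      by (subst integral_distr[OF _ \<phi>]) auto
  qed
  finally show ?thesis .
qed

text \<open>The conditional probabilities of single events determine the joint law of the outcome
  and \<open>Y\<close>, because both sides agree on rectangles, an intersection-stable generator.
  The outcome is seen only through \<open>F\<close>, so the mixing measure is \<open>M\<close>
  restricted to \<open>F\<close>.\<close>

lemma (in prob_space) distr_conditional_law:
  assumes F: "subalgebra M F" and Y: "Y \<in> M \<rightarrow>\<^sub>M N" and L: "L \<in> F \<rightarrow>\<^sub>M prob_algebra N"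
    and law: "\<And>A. A \<in> sets N \<Longrightarrow>
      AE \<omega> in M. real_cond_exp M F (\<lambda>\<omega>'. indicator A (Y \<omega>')) \<omega> = measure (L \<omega>) A"
  shows "distr M (F \<Otimes>\<^sub>M N) (\<lambda>\<omega>. (\<omega>, Y \<omega>))
    = Giry_Monad.bind (restr_to_subalg M F) (\<lambda>\<omega>. distr (L \<omega>) (F \<Otimes>\<^sub>M N) (Pair \<omega>))"
      (is "?P = Giry_Monad.bind ?M ?K")
proof -
  interpret finite_measure_subalgebra M F
    by unfold_locales (rule F)
  have sF: "space F = space M" using F by (simp add: subalgebra_def)
  have FM: "A \<in> sets F \<Longrightarrow> A \<in> sets M" for A using F by (auto simp: subalgebra_def)
  have L': "L \<in> F \<rightarrow>\<^sub>M subprob_algebra N" by (rule measurable_prob_algebraD[OF L])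
  have K: "?K \<in> F \<rightarrow>\<^sub>M subprob_algebra (F \<Otimes>\<^sub>M N)"
    by (rule measurable_distr2[OF _ L']) simp
  have K': "?K \<in> ?M \<rightarrow>\<^sub>M subprob_algebra (F \<Otimes>\<^sub>M N)"
    using K by (rule measurable_in_subalg[OF F])
  have ne: "space ?M \<noteq> {}" by (simp add: space_restr_to_subalg not_empty)
  have idF: "(\<lambda>\<omega>. \<omega>) \<in> M \<rightarrow>\<^sub>M F"
    using measurable_from_subalg[OF F measurable_ident] by (simp add: id_def)
  have pair: "(\<lambda>\<omega>. (\<omega>, Y \<omega>)) \<in> M \<rightarrow>\<^sub>M F \<Otimes>\<^sub>M N"
    using idF Y by simp
  let ?E = "{A \<times> B |A B. A \<in> sets F \<and> B \<in> sets N}"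
  show ?thesis
  proof (rule measure_eqI_generator_eq[OF Int_stable_pair_measure_generator[of F N]])
    show "?E \<subseteq> Pow (space F \<times> space N)"
      by (rule pair_measure_closed)
    show "sets ?P = sigma_sets (space F \<times> space N) ?E"
      by (simp add: sets_pair_measure)
    show "sets (Giry_Monad.bind ?M ?K) = sigma_sets (space F \<times> space N) ?E"
      by (simp add: sets_bind_measurable[OF K' ne] sets_pair_measure)
    show "range (\<lambda>_::nat. space F \<times> space N) \<subseteq> ?E" by auto
    show "(\<Union>i::nat. space F \<times> space N) = space F \<times> space N" by simp
    interpret P: prob_space ?P by (rule prob_space_distr[OF pair])
    show "emeasure ?P (space F \<times> space N) \<noteq> \<infinity>" by simp
    fix C assume "C \<in> ?E"
    then obtain A B where C: "C = A \<times> B" and A: "A \<in> sets F" and B: "B \<in> sets N" by auto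
    have AM: "A \<in> sets M" by (rule FM[OF A])
    have int: "integrable M (\<lambda>\<omega>. indicator B (Y \<omega>) :: real)"
      using measurable_compose[OF Y borel_measurable_indicator[OF B]]
      by (intro integrable_const_bound[of _ 1]) (auto simp: indicator_def)
    have meas: "(\<lambda>\<omega>. measure (L \<omega>) B) \<in> borel_measurable F"
      unfolding measure_def by (intro borel_measurable_enn2real measurable_emeasure_kernel[OF L' B])
    have measM: "(\<lambda>\<omega>. measure (L \<omega>) B) \<in> borel_measurable M"
      by (rule measurable_from_subalg[OF F meas])
    have le1: "measure (L \<omega>) B \<le> 1" if "\<omega> \<in> space M" for \<omega>
    proof -
      have "L \<omega> \<in> space (prob_algebra N)" using measurable_space[OF L] that sF by simp
      then interpret L: prob_space "L \<omega>" by (simp add: space_prob_algebra)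
      show ?thesis by simp
    qed
    have "measure ?P C = (\<integral>\<omega>\<in>A. indicator B (Y \<omega>) \<partial>M)"
    proof -
      have "measure ?P C = measure M ((\<lambda>\<omega>. (\<omega>, Y \<omega>)) -` C \<inter> space M)"
        by (rule measure_distr[OF pair]) (simp add: C A B)
      also have "\<dots> = (\<integral>\<omega>. indicator ((\<lambda>\<omega>. (\<omega>, Y \<omega>)) -` C \<inter> space M) \<omega> \<partial>M)"
        by simp
      also have "\<dots> = (\<integral>\<omega>\<in>A. indicator B (Y \<omega>) \<partial>M)"
        unfolding set_lebesgue_integral_def
        by (intro Bochner_Integration.integral_cong) (auto simp: C indicator_def)
      finally show ?thesis .
    qed
    \<comment> \<open>Defining property of the conditional expectation, applied to the
      \<open>F\<close>-measurable side \<open>A\<close> of the rectangle.\<close>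
    also have "\<dots> = (\<integral>\<omega>\<in>A. real_cond_exp M F (\<lambda>\<omega>. indicator B (Y \<omega>)) \<omega> \<partial>M)"
      by (rule real_cond_exp_intA[OF int A])
    also have "\<dots> = (\<integral>\<omega>\<in>A. measure (L \<omega>) B \<partial>M)"
      unfolding set_lebesgue_integral_def
      using law[OF B] AM measM by (intro integral_cong_AE) (auto elim: eventually_mono)
    also have "\<dots> = enn2real (\<integral>\<^sup>+\<omega>. ennreal (indicator A \<omega> * measure (L \<omega>) B) \<partial>M)"
      unfolding set_lebesgue_integral_def real_scaleR_def
      using AM measM by (subst integral_eq_nn_integral) (auto simp: indicator_def)
    finally have m: "measure ?P C = enn2real (\<integral>\<^sup>+\<omega>. ennreal (indicator A \<omega> * measure (L \<omega>) B) \<partial>M)" .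
    \<comment> \<open>\<open>enn2real\<close> sends infinity to 0, so finiteness is needed to
      recover the extended integral from its real value.\<close>
    have fin: "(\<integral>\<^sup>+\<omega>. ennreal (indicator A \<omega> * measure (L \<omega>) B) \<partial>M) < \<top>"
    proof -
      have "(\<integral>\<^sup>+\<omega>. ennreal (indicator A \<omega> * measure (L \<omega>) B) \<partial>M) \<le> (\<integral>\<^sup>+\<omega>. 1 \<partial>M)"
        using le1 by (intro nn_integral_mono) (auto simp: indicator_def)
      then show ?thesis by (simp add: emeasure_space_1 le_less_trans)
    qed
    have "emeasure ?P C = (\<integral>\<^sup>+\<omega>. ennreal (indicator A \<omega> * measure (L \<omega>) B) \<partial>M)"
      unfolding P.emeasure_eq_measure m using fin by simp
    also have "\<dots> = (\<integral>\<^sup>+\<omega>. ennreal (indicator A \<omega> * measure (L \<omega>) B) \<partial>?M)"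
      using A meas by (intro nn_integral_subalgebra2[OF F, symmetric]) simp
    also have "\<dots> = (\<integral>\<^sup>+\<omega>. emeasure (?K \<omega>) C \<partial>?M)"
    proof (rule nn_integral_cong)
      fix \<omega> assume "\<omega> \<in> space ?M"
      then have \<omega>: "\<omega> \<in> space F" by (simp add: space_restr_to_subalg sF)
      have "L \<omega> \<in> space (prob_algebra N)" using measurable_space[OF L \<omega>] .
      then interpret L: prob_space "L \<omega>" by (simp add: space_prob_algebra)
      have sets: "sets (L \<omega>) = sets N" by (rule sets_kernel[OF L' \<omega>])
      have "Pair \<omega> \<in> L \<omega> \<rightarrow>\<^sub>M F \<Otimes>\<^sub>M N"
        using measurable_Pair1'[OF \<omega>] measurable_cong_sets[OF sets refl] by blast
      then have "emeasure (?K \<omega>) C = emeasure (L \<omega>) (Pair \<omega> -` C \<inter> space (L \<omega>))"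
        by (rule emeasure_distr) (simp add: C A B)
      also have "Pair \<omega> -` C \<inter> space (L \<omega>) = (if \<omega> \<in> A then B else {})"
        using sets.sets_into_space[of B "L \<omega>"] B sets by (auto simp: C)
      also have "emeasure (L \<omega>) \<dots> = ennreal (indicator A \<omega> * measure (L \<omega>) B)"
        by (simp add: L.emeasure_eq_measure)
      finally show "ennreal (indicator A \<omega> * measure (L \<omega>) B) = emeasure (?K \<omega>) C" by simp
    qed
    also have "\<dots> = emeasure (Giry_Monad.bind ?M ?K) C"
      by (rule emeasure_bind[OF ne K', symmetric]) (simp add: C A B)
    finally show "emeasure ?P C = emeasure (Giry_Monad.bind ?M ?K) C" .
  qed
qed

text \<open>Given \<open>F\<close>, the first argument of \<phi> is frozen and only the second is
  drawn, from \<open>L \<omega>\<close>. This serves integrands that depend on the history through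
  the iterate; the uniform bound gives integrability.\<close>

lemma (in prob_space) expectation_conditional_law:
  fixes \<phi> :: "'a \<Rightarrow> 'b \<Rightarrow> real"
  assumes F: "subalgebra M F" and Y: "Y \<in> M \<rightarrow>\<^sub>M N" and L: "L \<in> F \<rightarrow>\<^sub>M prob_algebra N"
    and law: "\<And>A. A \<in> sets N \<Longrightarrow>
      AE \<omega> in M. real_cond_exp M F (\<lambda>\<omega>'. indicator A (Y \<omega>')) \<omega> = measure (L \<omega>) A"
    and \<phi>: "(\<lambda>(\<omega>, h). \<phi> \<omega> h) \<in> borel_measurable (F \<Otimes>\<^sub>M N)"
    and bound: "\<And>\<omega> h. \<omega> \<in> space M \<Longrightarrow> h \<in> space N \<Longrightarrow> \<bar>\<phi> \<omega> h\<bar> \<le> B"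
  shows "integrable M (\<lambda>\<omega>. \<phi> \<omega> (Y \<omega>))"
    and "integrable M (\<lambda>\<omega>. \<integral>h. \<phi> \<omega> h \<partial>L \<omega>)"
    and "(\<integral>\<omega>. \<phi> \<omega> (Y \<omega>) \<partial>M) = (\<integral>\<omega>. (\<integral>h. \<phi> \<omega> h \<partial>L \<omega>) \<partial>M)"
proof -
  let ?P = "distr M (F \<Otimes>\<^sub>M N) (\<lambda>\<omega>. (\<omega>, Y \<omega>))"
  let ?K = "\<lambda>\<omega>. distr (L \<omega>) (F \<Otimes>\<^sub>M N) (Pair \<omega>)"
  have sF: "space F = space M" using F by (simp add: subalgebra_def)
  have L': "L \<in> F \<rightarrow>\<^sub>M subprob_algebra N" by (rule measurable_prob_algebraD[OF L])
  have pL: "prob_space (L \<omega>)" and sL: "sets (L \<omega>) = sets N"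
    and Pm: "Pair \<omega> \<in> L \<omega> \<rightarrow>\<^sub>M F \<Otimes>\<^sub>M N" if "\<omega> \<in> space M" for \<omega>
  proof -
    have \<omega>: "\<omega> \<in> space F" using that sF by simp
    show "prob_space (L \<omega>)" using measurable_space[OF L \<omega>] by (simp add: space_prob_algebra)
    show *: "sets (L \<omega>) = sets N" by (rule sets_kernel[OF L' \<omega>])
    show "Pair \<omega> \<in> L \<omega> \<rightarrow>\<^sub>M F \<Otimes>\<^sub>M N"
      using measurable_Pair1'[OF \<omega>] measurable_cong_sets[OF * refl] by blast
  qed
  have K: "?K \<in> F \<rightarrow>\<^sub>M subprob_algebra (F \<Otimes>\<^sub>M N)"
    by (rule measurable_distr2[OF _ L']) simp
  have K': "?K \<in> restr_to_subalg M F \<rightarrow>\<^sub>M subprob_algebra (F \<Otimes>\<^sub>M N)"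
    using K by (rule measurable_in_subalg[OF F])
  have idF: "(\<lambda>\<omega>. \<omega>) \<in> M \<rightarrow>\<^sub>M F"
    using measurable_from_subalg[OF F measurable_ident] by (simp add: id_def)
  have pair: "(\<lambda>\<omega>. (\<omega>, Y \<omega>)) \<in> M \<rightarrow>\<^sub>M F \<Otimes>\<^sub>M N"
    using idF Y by simp
  have \<phi>Y: "(\<lambda>\<omega>. \<phi> \<omega> (Y \<omega>)) \<in> borel_measurable M"
    using measurable_compose[OF pair \<phi>] by simp
  show "integrable M (\<lambda>\<omega>. \<phi> \<omega> (Y \<omega>))"
    using bound measurable_space[OF Y] \<phi>Y by (intro integrable_const_bound[of _ B]) auto
  have inner: "(\<lambda>\<omega>. \<integral>h. \<phi> \<omega> h \<partial>L \<omega>) \<in> borel_measurable F"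
    by (rule integral_measurable_kernel[OF \<phi> L'])
  have abs_inner: "\<bar>\<integral>h. \<phi> \<omega> h \<partial>L \<omega>\<bar> \<le> B" if \<omega>: "\<omega> \<in> space M" for \<omega>
  proof -
    interpret L: prob_space "L \<omega>" by (rule pL[OF \<omega>])
    have b: "\<bar>\<phi> \<omega> h\<bar> \<le> B" if "h \<in> space (L \<omega>)" for h
      using bound[OF \<omega>] that sets_eq_imp_space_eq[OF sL[OF \<omega>]] by simp
    have m: "\<phi> \<omega> \<in> borel_measurable (L \<omega>)"
      using measurable_compose[OF Pm[OF \<omega>] \<phi>] by simp
    have "integrable (L \<omega>) (\<phi> \<omega>)"
      using b m by (intro L.integrable_const_bound[of _ B]) auto
    then have "\<bar>\<integral>h. \<phi> \<omega> h \<partial>L \<omega>\<bar> \<le> (\<integral>h. \<bar>\<phi> \<omega> h\<bar> \<partial>L \<omega>)" by simp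
    also have "\<dots> \<le> B"
      using b \<open>integrable (L \<omega>) (\<phi> \<omega>)\<close> by (intro L.integral_le_const) auto
    finally show ?thesis .
  qed
  show "integrable M (\<lambda>\<omega>. \<integral>h. \<phi> \<omega> h \<partial>L \<omega>)"
    using abs_inner measurable_from_subalg[OF F inner] by (intro integrable_const_bound[of _ B]) auto
  have joint: "?P = Giry_Monad.bind (restr_to_subalg M F) ?K"
    by (rule distr_conditional_law[OF F Y L]) (rule law)
  have "(\<integral>\<omega>. \<phi> \<omega> (Y \<omega>) \<partial>M) = (\<integral>p. (case p of (\<omega>, h) \<Rightarrow> \<phi> \<omega> h) \<partial>?P)"
    by (subst integral_distr[OF pair \<phi>]) simp
  also have "\<dots> = (\<integral>\<omega>. (\<integral>p. (case p of (\<omega>, h) \<Rightarrow> \<phi> \<omega> h) \<partial>?K \<omega>) \<partial>restr_to_subalg M F)"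
    unfolding joint
  proof (rule integral_bind[OF \<phi> _ K', where B=B and B'=1])
    show "\<bar>case p of (\<omega>, h) \<Rightarrow> \<phi> \<omega> h\<bar> \<le> B" if "p \<in> space (F \<Otimes>\<^sub>M N)" for p
      using that bound sF by (auto simp: space_pair_measure)
    show "finite_measure (restr_to_subalg M F)"
      by (rule finite_measure_restr_to_subalg[OF F]) unfold_locales
    show "AE \<omega> in restr_to_subalg M F. emeasure (?K \<omega>) (space (?K \<omega>)) \<le> ennreal 1"
    proof (rule AE_I2)
      fix \<omega> assume "\<omega> \<in> space (restr_to_subalg M F)"
      then have "\<omega> \<in> space F" by (simp add: space_restr_to_subalg sF)
      then have "subprob_space (?K \<omega>)" by (rule subprob_space_kernel[OF K])
      then show "emeasure (?K \<omega>) (space (?K \<omega>)) \<le> ennreal 1"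
        using subprob_space.subprob_emeasure_le_1 by simp
    qed
  qed
  also have "\<dots> = (\<integral>\<omega>. (\<integral>h. \<phi> \<omega> h \<partial>L \<omega>) \<partial>restr_to_subalg M F)"
  proof (rule Bochner_Integration.integral_cong[OF refl])
    fix \<omega> assume "\<omega> \<in> space (restr_to_subalg M F)"
    then have \<omega>: "\<omega> \<in> space M" by (simp add: space_restr_to_subalg)
    show "(\<integral>p. (case p of (\<omega>, h) \<Rightarrow> \<phi> \<omega> h) \<partial>?K \<omega>) = (\<integral>h. \<phi> \<omega> h \<partial>L \<omega>)"
      by (subst integral_distr[OF Pm[OF \<omega>] \<phi>]) simp
  qed
  also have "\<dots> = (\<integral>\<omega>. (\<integral>h. \<phi> \<omega> h \<partial>L \<omega>) \<partial>M)"
    by (rule integral_subalgebra2[OF F inner])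
  finally show "(\<integral>\<omega>. \<phi> \<omega> (Y \<omega>) \<partial>M) = (\<integral>\<omega>. (\<integral>h. \<phi> \<omega> h \<partial>L \<omega>) \<partial>M)" .
qed

section \<open>Jensen's inequality for the square root and the first-order condition for
  convexity\<close>

lemma (in prob_space) expectation_sqrt_le:
  assumes Y: "Y \<in> borel_measurable M" and bound: "\<And>\<omega>. \<omega> \<in> space M \<Longrightarrow> 0 \<le> Y \<omega> \<and> Y \<omega> \<le> (B::real)"
  shows "integrable M Y" "integrable M (\<lambda>\<omega>. sqrt (Y \<omega>))"
    "(\<integral>\<omega>. sqrt (Y \<omega>) \<partial>M) \<le> sqrt (\<integral>\<omega>. Y \<omega> \<partial>M)"
proof -
  show iY: "integrable M Y"
    using bound Y by (intro integrable_const_bound[of _ B]) auto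
  show int_sqrt: "integrable M (\<lambda>\<omega>. sqrt (Y \<omega>))"
    using bound Y by (intro integrable_const_bound[of _ "sqrt B"]) auto
  have sq: "(\<integral>\<omega>. (sqrt (Y \<omega>))\<^sup>2 \<partial>M) = (\<integral>\<omega>. Y \<omega> \<partial>M)"
    using bound by (intro Bochner_Integration.integral_cong) auto
  have "integrable M (\<lambda>\<omega>. (sqrt (Y \<omega>))\<^sup>2)"
    using iY by (rule Bochner_Integration.integrable_cong[THEN iffD1, rotated -1]) (use bound in auto)
  \<comment> \<open>Jensen's inequality is read off from the nonnegativity of the variance of
    \<open>sqrt (Y \<omega>)\<close>.\<close>
  then have "variance (\<lambda>\<omega>. sqrt (Y \<omega>)) = (\<integral>\<omega>. Y \<omega> \<partial>M) - (\<integral>\<omega>. sqrt (Y \<omega>) \<partial>M)\<^sup>2"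
    using variance_eq[OF int_sqrt] sq by simp
  then have "(\<integral>\<omega>. sqrt (Y \<omega>) \<partial>M)\<^sup>2 \<le> (\<integral>\<omega>. Y \<omega> \<partial>M)"
    using variance_positive[of "\<lambda>\<omega>. sqrt (Y \<omega>)"] by simp
  then show "(\<integral>\<omega>. sqrt (Y \<omega>) \<partial>M) \<le> sqrt (\<integral>\<omega>. Y \<omega> \<partial>M)"
    by (rule real_le_rsqrt)
qed

text \<open>Along the segment from \<open>y\<close> to \<open>z\<close>, convexity bounds the
  difference quotients at 0 by \<open>F z - F y\<close>, and they tend to
  \<open>a \<bullet> (z - y)\<close>. The segment stays in \<open>X\<close>, so a derivative within
  \<open>X\<close> suffices even if \<open>X\<close> has empty interior.\<close>

lemma convex_on_gradient_le:
  fixes F :: "'a::euclidean_space \<Rightarrow> real"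
  assumes F: "convex_on X F" and d: "(F has_derivative (\<lambda>v. a \<bullet> v)) (at y within X)"
    and y: "y \<in> X" and z: "z \<in> X"
  shows "F y - F z \<le> a \<bullet> (y - z)"
proof -
  define p where "p s = y + s *\<^sub>R (z - y)" for s :: real
  have X: "convex X" using F by (simp add: convex_on_def)
  have p_alt: "p s = (1 - s) *\<^sub>R y + s *\<^sub>R z" for s
    by (simp add: p_def algebra_simps)
  have p: "p ` {0..1} \<subseteq> X"
    using convexD_alt[OF X y z] by (auto simp: p_alt)
  have dp: "(p has_derivative (\<lambda>s. s *\<^sub>R (z - y))) (at 0 within {0..1})"
    unfolding p_def by (auto intro!: derivative_eq_intros)
  have "p 0 = y" by (simp add: p_def)
  then have "(F has_derivative (\<lambda>v. a \<bullet> v)) (at (p 0) within p ` {0..1})"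
    using has_derivative_subset[OF d p] by simp
  from has_derivative_in_compose[OF dp this]
  have "((\<lambda>s. F (p s)) has_field_derivative (a \<bullet> (z - y))) (at 0 within {0..1})"
    by (simp add: has_field_derivative_def mult_commute_abs)
  then have lim: "((\<lambda>s. (F (p s) - F (p 0)) / (s - 0)) \<longlongrightarrow> a \<bullet> (z - y)) (at 0 within {0..1})"
    by (simp add: has_field_derivative_iff)
  have "a \<bullet> (z - y) \<le> F z - F y"
  proof (rule tendsto_upperbound[OF lim])
    show "\<forall>\<^sub>F s in at 0 within {0..1}. (F (p s) - F (p 0)) / (s - 0) \<le> F z - F y"
      unfolding eventually_at_filter
    proof (intro always_eventually allI impI)
      fix s :: real assume "s \<noteq> 0" "s \<in> {0..1}"
      then have s: "0 < s" "s \<le> 1" by auto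
      have "F (p s) \<le> (1 - s) * F y + s * F z"
        unfolding p_alt using convex_onD[OF F, of s y z] y z s by simp
      then have "F (p s) - F y \<le> s * (F z - F y)" by (simp add: algebra_simps)
      then show "(F (p s) - F (p 0)) / (s - 0) \<le> F z - F y"
        using s \<open>p 0 = y\<close> by (simp add: field_simps)
    qed
    show "at (0::real) within {0..1} \<noteq> bot"
      by (simp add: trivial_limit_within islimpt_Icc)
  qed
  then show ?thesis by (simp add: inner_diff_right)
qed

section \<open>The SEA model\<close>

text \<open>After the triangle inequality, the gap between the two sides is the sum of the six
  squared differences of the norms.\<close>

lemma norm_add4_squared_le:
  fixes a b c d :: "'a::real_normed_vector"
  shows "(norm (a + b + c + d))\<^sup>2 \<le> 4 * ((norm a)\<^sup>2 + (norm b)\<^sup>2 + (norm c)\<^sup>2 + (norm d)\<^sup>2)"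
proof -
  have "norm (a + b + c + d) \<le> norm a + norm b + norm c + norm d"
    by (intro norm_triangle_le add_right_mono) (auto intro: norm_triangle_ineq)
  then have "(norm (a + b + c + d))\<^sup>2 \<le> (norm a + norm b + norm c + norm d)\<^sup>2"
    by (intro power_mono) auto
  moreover have "(norm a + norm b + norm c + norm d)\<^sup>2
      + ((norm a - norm b)\<^sup>2 + (norm a - norm c)\<^sup>2 + (norm a - norm d)\<^sup>2
      + (norm b - norm c)\<^sup>2 + (norm b - norm d)\<^sup>2 + (norm c - norm d)\<^sup>2)
      = 4 * ((norm a)\<^sup>2 + (norm b)\<^sup>2 + (norm c)\<^sup>2 + (norm d)\<^sup>2)"
    by (simp add: power2_eq_square algebra_simps)
  moreover have "0 \<le> (norm a - norm b)\<^sup>2 + (norm a - norm c)\<^sup>2 + (norm a - norm d)\<^sup>2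
      + (norm b - norm c)\<^sup>2 + (norm b - norm d)\<^sup>2 + (norm c - norm d)\<^sup>2"
    by simp
  ultimately show ?thesis by linarith
qed

text \<open>Assigns what a round inherits from its predecessor back to that predecessor; round 1 has
  none, hence the value 0.\<close>

lemma sum_shift_one:
  fixes d :: "nat \<Rightarrow> 'a::comm_monoid_add"
  shows "(\<Sum>t=1..n. if t = 1 then 0 else d (t - 1)) = (\<Sum>t\<in>{1..<n}. d t)"
proof (induction n)
  case (Suc n)
  then show ?case by (cases "n = 0") auto
qed simp

text \<open>Gathers model, algorithm and comparator so that the lemmas below share them. The
  gradient bound covers all of \<open>space N\<close> and therefore survives averaging over any
  \<open>Dist t \<omega>\<close>.\<close>

locale sea_oftrl = sea_model M X T N grad H Dist f
  for M :: "'w measure"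
    and X :: "'a::euclidean_space set"
    and T :: nat
    and N :: "('a \<Rightarrow> real) measure"
    and grad :: "('a \<Rightarrow> real) \<Rightarrow> 'a \<Rightarrow> 'a"
    and H :: "nat \<Rightarrow> 'w measure"
    and Dist :: "nat \<Rightarrow> 'w \<Rightarrow> ('a \<Rightarrow> real) measure"
    and f :: "nat \<Rightarrow> 'w \<Rightarrow> 'a \<Rightarrow> real" +
  fixes x :: "nat \<Rightarrow> 'w \<Rightarrow> 'a"
    and \<eta> :: "nat \<Rightarrow> 'w \<Rightarrow> real"
    and D G L :: real
    and u :: 'a
  assumes pos: "G > 0" "D > 0" "L > 0"
    and grad_bound: "\<And>h y. h \<in> space N \<Longrightarrow> y \<in> X \<Longrightarrow> norm (grad h y) \<le> G"
    and zero_in: "0 \<in> X"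
    and diameter: "\<And>y z. y \<in> X \<Longrightarrow> z \<in> X \<Longrightarrow> norm (y - z) \<le> D"
    and smooth: "\<And>t \<omega> y z. t \<in> {1..T} \<Longrightarrow> \<omega> \<in> space M \<Longrightarrow> y \<in> X \<Longrightarrow> z \<in> X \<Longrightarrow>
        norm (exp_grad grad (Dist t \<omega>) y - exp_grad grad (Dist t \<omega>) z) \<le> L * norm (y - z)"
    and convex_exp: "\<And>t \<omega>. t \<in> {1..T} \<Longrightarrow> \<omega> \<in> space M \<Longrightarrow> convex_on X (exp_fun (Dist t \<omega>))"
    and step_size: "\<And>t \<omega>. t \<in> {1..T} \<Longrightarrow> \<omega> \<in> space M \<Longrightarrow>
        oftrl_step D (oftrl_delta D G L) (\<lambda>s. obs_grad grad f x s \<omega>) (\<lambda>s. \<eta> s \<omega>) t"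
    and iterates: "\<And>t \<omega>. t \<in> {1..T} \<Longrightarrow> \<omega> \<in> space M \<Longrightarrow>
        is_arg_min (oftrl_objective (\<lambda>s. obs_grad grad f x s \<omega>) (\<lambda>s. \<eta> s \<omega>) (\<lambda>s. x s \<omega>) t)
          (\<lambda>y. y \<in> X) (x t \<omega>)"
    and comparator: "u \<in> X"
begin

abbreviation \<delta> :: real where "\<delta> \<equiv> oftrl_delta D G L"
abbreviation g :: "nat \<Rightarrow> 'w \<Rightarrow> 'a" where "g \<equiv> obs_grad grad f x"
abbreviation \<Delta> :: "nat \<Rightarrow> 'w \<Rightarrow> real" where "\<Delta> t \<omega> \<equiv> (norm (g t \<omega> - g (t - 1) \<omega>))\<^sup>2"

text \<open>Taken at the iterate and not as a supremum over \<open>X\<close>: the history fixes the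
  iterate, so the conditional mean is a variance at a single point.\<close>

definition noise :: "nat \<Rightarrow> 'w \<Rightarrow> real" where
  "noise t \<omega> = (norm (grad (f t \<omega>) (x t \<omega>) - exp_grad grad (Dist t \<omega>) (x t \<omega>)))\<^sup>2"

section \<open>Uniform bounds on gradients, variations and variances\<close>

lemma delta_pos: "\<delta> > 0"
  using pos by (simp add: oftrl_delta_def add_pos_pos)

lemma delta_squared: "\<delta>\<^sup>2 = 9 * D^4 * L + 6 * D\<^sup>2 * G\<^sup>2"
  using pos by (simp add: oftrl_delta_def)

lemma iterate_in: "t \<in> {1..T} \<Longrightarrow> \<omega> \<in> space M \<Longrightarrow> x t \<omega> \<in> X"
  using iterates[of t \<omega>] by (simp add: is_arg_min_def)

lemma sampled_in: "t \<in> {1..T} \<Longrightarrow> \<omega> \<in> space M \<Longrightarrow> f t \<omega> \<in> space N"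
  using measurable_space[OF sampled] .

lemma space_history: "t \<in> {1..T} \<Longrightarrow> space (H t) = space M"
  using history[of t] by (simp add: subalgebra_def)

lemma
  assumes "t \<in> {1..T}" and "\<omega> \<in> space M"
  shows prob_space_Dist: "prob_space (Dist t \<omega>)"
    and sets_Dist: "sets (Dist t \<omega>) = sets N"
    and space_Dist: "space (Dist t \<omega>) = space N"
proof -
  have "Dist t \<omega> \<in> space (prob_algebra N)"
    using measurable_space[OF distributions[of t t]] assms space_history by auto
  then show "prob_space (Dist t \<omega>)" and *: "sets (Dist t \<omega>) = sets N"
    by (simp_all add: space_prob_algebra)
  from sets_eq_imp_space_eq[OF *] show "space (Dist t \<omega>) = space N" .
qed

lemma kernel: "t \<in> {1..T} \<Longrightarrow> Dist t \<in> H t \<rightarrow>\<^sub>M subprob_algebra N"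
  using distributions[of t t] by (intro measurable_prob_algebraD) auto

lemma grad_integrable:
  assumes t: "t \<in> {1..T}" and \<omega>: "\<omega> \<in> space M" and y: "y \<in> X"
  shows "integrable (Dist t \<omega>) (\<lambda>h. grad h y)"
proof -
  interpret P: prob_space "Dist t \<omega>" by (rule prob_space_Dist[OF t \<omega>])
  have "(\<lambda>h. (h, y)) \<in> N \<rightarrow>\<^sub>M N \<Otimes>\<^sub>M restrict_space borel X"
    using y by (intro measurable_Pair) (auto simp: space_restrict_space)
  from measurable_compose[OF this grad_measurable]
  have "(\<lambda>h. grad h y) \<in> borel_measurable (Dist t \<omega>)"
    by (simp add: measurable_cong_sets[OF sets_Dist[OF t \<omega>] refl])
  then show ?thesis
    using grad_bound y by (intro P.integrable_const_bound[of _ G]) (auto simp: space_Dist[OF t \<omega>])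
qed

lemma exp_grad_bound:
  assumes t: "t \<in> {1..T}" and \<omega>: "\<omega> \<in> space M" and y: "y \<in> X"
  shows "norm (exp_grad grad (Dist t \<omega>) y) \<le> G"
proof -
  interpret P: prob_space "Dist t \<omega>" by (rule prob_space_Dist[OF t \<omega>])
  have "norm (exp_grad grad (Dist t \<omega>) y) \<le> (\<integral>h. norm (grad h y) \<partial>Dist t \<omega>)"
    unfolding exp_grad_def by (rule integral_norm_bound)
  also have "\<dots> \<le> G"
    using grad_bound y grad_integrable[OF t \<omega> y]
    by (intro P.integral_le_const) (auto simp: space_Dist[OF t \<omega>])
  finally show ?thesis .
qed

lemma norm_diff_squared_bound: "norm a \<le> G \<Longrightarrow> norm b \<le> G \<Longrightarrow> (norm (a - b))\<^sup>2 \<le> 4 * G\<^sup>2"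
  for a b :: 'a
proof -
  assume "norm a \<le> G" "norm b \<le> G"
  then have "norm (a - b) \<le> 2 * G" using norm_triangle_ineq4[of a b] by linarith
  then have "(norm (a - b))\<^sup>2 \<le> (2 * G)\<^sup>2" by (intro power_mono) auto
  then show ?thesis by (simp add: power_mult_distrib)
qed

lemma obs_grad_bound: "t \<le> T \<Longrightarrow> \<omega> \<in> space M \<Longrightarrow> norm (g t \<omega>) \<le> G"
  using pos by (auto simp: obs_grad_def intro!: grad_bound sampled_in iterate_in)

text \<open>A real supremum dominates its members only if they are bounded above, which
  \<open>4 * G^2\<close> guarantees. Nonnegativity is seen at the point 0 of
  \<open>X\<close>.\<close>

lemma
  assumes t: "t \<in> {1..T}" and \<omega>: "\<omega> \<in> space M"
  shows grad_variation_bounds: "0 \<le> grad_variation grad X Dist t \<omega>"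
      "grad_variation grad X Dist t \<omega> \<le> 4 * G\<^sup>2"
    and grad_variation_ge: "y \<in> X \<Longrightarrow>
      (norm (exp_grad_seq grad Dist t \<omega> y - exp_grad_seq grad Dist (t - 1) \<omega> y))\<^sup>2
      \<le> grad_variation grad X Dist t \<omega>"
proof -
  let ?v = "\<lambda>y. (norm (exp_grad_seq grad Dist t \<omega> y - exp_grad_seq grad Dist (t - 1) \<omega> y))\<^sup>2"
  have seq: "norm (exp_grad_seq grad Dist s \<omega> y) \<le> G" if "s \<le> T" "y \<in> X" for s y
    using that pos \<omega> by (auto simp: exp_grad_seq_def intro!: exp_grad_bound)
  have le: "?v y \<le> 4 * G\<^sup>2" if "y \<in> X" for y
    using t that by (intro norm_diff_squared_bound seq) auto
  have bdd: "bdd_above (?v ` X)" using le by (intro bdd_aboveI2) auto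
  show upper: "?v y \<le> grad_variation grad X Dist t \<omega>" if "y \<in> X" for y
    unfolding grad_variation_def using bdd that by (rule cSUP_upper2) simp
  show "grad_variation grad X Dist t \<omega> \<le> 4 * G\<^sup>2"
    unfolding grad_variation_def using domain(1) le by (rule cSUP_least)
  show "0 \<le> grad_variation grad X Dist t \<omega>"
    using upper[OF zero_in] by (rule order_trans[rotated]) simp
qed

lemma
  assumes t: "t \<in> {1..T}" and \<omega>: "\<omega> \<in> space M"
  shows grad_variance_bounds: "0 \<le> grad_variance grad X (Dist t \<omega>)"
      "grad_variance grad X (Dist t \<omega>) \<le> 4 * G\<^sup>2"
    and grad_variance_ge: "y \<in> X \<Longrightarrow>
      (\<integral>h. (norm (grad h y - exp_grad grad (Dist t \<omega>) y))\<^sup>2 \<partial>Dist t \<omega>)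
      \<le> grad_variance grad X (Dist t \<omega>)"
proof -
  interpret P: prob_space "Dist t \<omega>" by (rule prob_space_Dist[OF t \<omega>])
  let ?v = "\<lambda>y. \<integral>h. (norm (grad h y - exp_grad grad (Dist t \<omega>) y))\<^sup>2 \<partial>Dist t \<omega>"
  have le: "?v y \<le> 4 * G\<^sup>2" if y: "y \<in> X" for y
  proof (rule P.integral_le_const)
    have b: "AE h in Dist t \<omega>. (norm (grad h y - exp_grad grad (Dist t \<omega>) y))\<^sup>2 \<le> 4 * G\<^sup>2"
      using y by (intro AE_I2 norm_diff_squared_bound grad_bound exp_grad_bound t \<omega>)
        (auto simp: space_Dist[OF t \<omega>])
    then show "integrable (Dist t \<omega>) (\<lambda>h. (norm (grad h y - exp_grad grad (Dist t \<omega>) y))\<^sup>2)"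
      using grad_integrable[OF t \<omega> y] by (intro P.integrable_const_bound[of _ "4 * G\<^sup>2"]) auto
    show "AE h in Dist t \<omega>. (norm (grad h y - exp_grad grad (Dist t \<omega>) y))\<^sup>2 \<le> 4 * G\<^sup>2" by (rule b)
  qed
  have bdd: "bdd_above (?v ` X)" using le by (intro bdd_aboveI2) auto
  show upper: "?v y \<le> grad_variance grad X (Dist t \<omega>)" if "y \<in> X" for y
    unfolding grad_variance_def using bdd that by (rule cSUP_upper2) simp
  show "grad_variance grad X (Dist t \<omega>) \<le> 4 * G\<^sup>2"
    unfolding grad_variance_def using domain(1) le by (rule cSUP_least)
  show "0 \<le> grad_variance grad X (Dist t \<omega>)"
    using upper[OF zero_in] by (rule order_trans[rotated]) simp
qed

section \<open>Regret bound for a fixed outcome\<close>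

lemma step_size_eq:
  "t \<in> {1..T} \<Longrightarrow> \<omega> \<in> space M \<Longrightarrow> \<eta> t \<omega> = D\<^sup>2 / (\<delta> + (\<Sum>s\<in>{1..<t}. \<eta> s \<omega> * \<Delta> s \<omega>))"
  using step_size by (simp add: oftrl_step_def)

lemma
  assumes \<omega>: "\<omega> \<in> space M"
  shows step_size_pos: "\<And>t. t \<in> {1..T} \<Longrightarrow> \<eta> t \<omega> > 0"
    and step_size_mono: "\<And>t. t \<in> {1..<T} \<Longrightarrow> \<eta> (Suc t) \<omega> \<le> \<eta> t \<omega>"
    and step_size_inverse_ge: "\<And>t. t \<in> {1..T} \<Longrightarrow> \<delta> / D\<^sup>2 \<le> 1 / \<eta> t \<omega>"
    and step_size_sum_le:
      "\<delta> + (\<Sum>s=1..T. \<eta> s \<omega> * \<Delta> s \<omega>) \<le> \<delta> + 5 / 3 * D * sqrt (\<Sum>s=1..T. \<Delta> s \<omega>)"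
proof -
  have \<delta>: "6 * D\<^sup>2 * G\<^sup>2 \<le> \<delta>\<^sup>2" using pos by (simp add: delta_squared)
  have \<Delta>: "0 \<le> \<Delta> t \<omega> \<and> \<Delta> t \<omega> \<le> 4 * G\<^sup>2" if "t \<in> {1..T}" for t
    using that \<omega> by (auto intro!: norm_diff_squared_bound obs_grad_bound)
  note * = step_size_growth[where \<eta> = "\<lambda>t. \<eta> t \<omega>" and \<Delta> = "\<lambda>t. \<Delta> t \<omega>" and T = T,
      OF pos(2) delta_pos \<delta> \<Delta> step_size_eq[OF _ \<omega>]]
  show "\<And>t. t \<in> {1..T} \<Longrightarrow> \<eta> t \<omega> > 0" by (rule *(1))
  show "\<And>t. t \<in> {1..<T} \<Longrightarrow> \<eta> (Suc t) \<omega> \<le> \<eta> t \<omega>" by (rule *(2))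
  show "\<And>t. t \<in> {1..T} \<Longrightarrow> \<delta> / D\<^sup>2 \<le> 1 / \<eta> t \<omega>" by (rule *(3))
  show "\<delta> + (\<Sum>s=1..T. \<eta> s \<omega> * \<Delta> s \<omega>) \<le> \<delta> + 5 / 3 * D * sqrt (\<Sum>s=1..T. \<Delta> s \<omega>)" by (rule *(4))
qed

text \<open>Consecutive observed gradients are compared through expected gradients. The noise of a
  round enters in that round and in the next, which doubles its factor 4 to 8.\<close>

lemma sum_gradient_differences_le:
  assumes \<omega>: "\<omega> \<in> space M"
  shows "(\<Sum>t=1..T. \<Delta> t \<omega>) \<le> 8 * (\<Sum>t=1..T. noise t \<omega>) + 4 * (\<Sum>t=1..T. grad_variation grad X Dist t \<omega>)
      + 4 * L\<^sup>2 * (\<Sum>t\<in>{1..<T}. (norm (x (Suc t) \<omega> - x t \<omega>))\<^sup>2)"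
proof -
  let ?V = "\<lambda>t. grad_variation grad X Dist t \<omega>"
  \<comment> \<open>What round \<open>t\<close> passes on to round \<open>t + 1\<close>: the move,
    weighted by smoothness, and its own noise.\<close>
  define d where "d t = L\<^sup>2 * (norm (x (Suc t) \<omega> - x t \<omega>))\<^sup>2 + noise t \<omega>" for t
  have "\<Delta> t \<omega> \<le> 4 * (noise t \<omega> + ?V t + (if t = 1 then 0 else d (t - 1)))" if t: "t \<in> {1..T}" for t
  proof -
    let ?F = "\<lambda>t. exp_grad_seq grad Dist t \<omega>"
    have V: "(norm (?F t (x t \<omega>) - ?F (t - 1) (x t \<omega>)))\<^sup>2 \<le> ?V t"
      by (rule grad_variation_ge[OF t \<omega> iterate_in[OF t \<omega>]])
    \<comment> \<open>The change of expected function is measured at the common point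
      \<open>x t \<omega>\<close>, and the move under the single field \<open>?F (t - 1)\<close>,
      where smoothness applies.\<close>
    have split: "g t \<omega> - g (t - 1) \<omega> = (g t \<omega> - ?F t (x t \<omega>)) + (?F t (x t \<omega>) - ?F (t - 1) (x t \<omega>))
        + (?F (t - 1) (x t \<omega>) - ?F (t - 1) (x (t - 1) \<omega>)) + (?F (t - 1) (x (t - 1) \<omega>) - g (t - 1) \<omega>)"
      by simp
    have "\<Delta> t \<omega> \<le> 4 * ((norm (g t \<omega> - ?F t (x t \<omega>)))\<^sup>2 + (norm (?F t (x t \<omega>) - ?F (t - 1) (x t \<omega>)))\<^sup>2
        + (norm (?F (t - 1) (x t \<omega>) - ?F (t - 1) (x (t - 1) \<omega>)))\<^sup>2
        + (norm (?F (t - 1) (x (t - 1) \<omega>) - g (t - 1) \<omega>))\<^sup>2)"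
      unfolding split by (rule norm_add4_squared_le)
    moreover have "(norm (g t \<omega> - ?F t (x t \<omega>)))\<^sup>2 = noise t \<omega>"
      using t by (simp add: noise_def obs_grad_def exp_grad_seq_def)
    moreover have "(norm (?F (t - 1) (x t \<omega>) - ?F (t - 1) (x (t - 1) \<omega>)))\<^sup>2
        + (norm (?F (t - 1) (x (t - 1) \<omega>) - g (t - 1) \<omega>))\<^sup>2 \<le> (if t = 1 then 0 else d (t - 1))"
    proof (cases "t = 1")
      \<comment> \<open>Expected and observed gradients of round 0 are both zero by
        convention.\<close>
      case True
      then show ?thesis by (simp add: exp_grad_seq_def obs_grad_def)
    next
      case False
      then have s: "t - 1 \<in> {1..T}" "t - 1 \<noteq> 0" "Suc (t - 1) = t" using t by auto
      have "norm (?F (t - 1) (x t \<omega>) - ?F (t - 1) (x (t - 1) \<omega>)) \<le> L * norm (x t \<omega> - x (t - 1) \<omega>)"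
        using smooth[OF s(1) \<omega> iterate_in[OF t \<omega>] iterate_in[OF s(1) \<omega>]] s(2)
        by (simp add: exp_grad_seq_def)
      then have "(norm (?F (t - 1) (x t \<omega>) - ?F (t - 1) (x (t - 1) \<omega>)))\<^sup>2
          \<le> (L * norm (x t \<omega> - x (t - 1) \<omega>))\<^sup>2"
        by (intro power_mono) auto
      then show ?thesis using False s(2,3)
        by (simp add: d_def noise_def obs_grad_def exp_grad_seq_def power_mult_distrib norm_minus_commute)
    qed
    moreover have "a \<le> 4 * (n + v + c)"
      if "a \<le> 4 * (p + q + r + s)" "p = n" "r + s \<le> c" "q \<le> v" for a n v c p q r s :: real
      using that unfolding distrib_left by linarith
    ultimately show ?thesis using V by blast
  qed
  then have "(\<Sum>t=1..T. \<Delta> t \<omega>) \<le> (\<Sum>t=1..T. 4 * (noise t \<omega> + ?V t + (if t = 1 then 0 else d (t - 1))))"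
    by (rule sum_mono)
  also have "\<dots> = 4 * ((\<Sum>t=1..T. noise t \<omega>) + (\<Sum>t=1..T. ?V t) + (\<Sum>t\<in>{1..<T}. d t))"
    by (simp only: sum_distrib_left[symmetric] sum.distrib sum_shift_one)
  also have "(\<Sum>t\<in>{1..<T}. d t) \<le> L\<^sup>2 * (\<Sum>t\<in>{1..<T}. (norm (x (Suc t) \<omega> - x t \<omega>))\<^sup>2) + (\<Sum>t=1..T. noise t \<omega>)"
    unfolding d_def sum.distrib sum_distrib_left
    by (intro add_left_mono sum_mono2) (auto simp: noise_def)
  finally show ?thesis by (simp add: algebra_simps)
qed

text \<open>Let \<open>W\<close> be the sum of
  \<open>\<eta> t \<omega> * \<Delta> t \<omega>\<close>. As
  \<open>D^2 / \<eta> T \<omega> \<le> \<delta> + W\<close>, the regret is at most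
  \<open>\<delta> + 3 / 2 * W\<close> minus the moves. The factor \<open>3 / 2\<close> turns the
  coefficients 5 and \<open>10 / 3\<close> in the bound on \<open>W\<close> into
  \<open>15 / 2\<close> and 5.\<close>

lemma pathwise_regret:
  assumes \<omega>: "\<omega> \<in> space M"
  shows "(\<Sum>t=1..T. g t \<omega> \<bullet> (x t \<omega> - u)) \<le> \<delta> + 25 / 2 * (D^4 * L\<^sup>2 / \<delta>)
      + 15 / 2 * D * sqrt (\<Sum>t=1..T. noise t \<omega>)
      + 5 * D * sqrt (\<Sum>t=1..T. grad_variation grad X Dist t \<omega>)"
proof -
  define P where "P = (\<Sum>t\<in>{1..<T}. (norm (x (Suc t) \<omega> - x t \<omega>))\<^sup>2)"
  define E where "E = (\<Sum>t=1..T. noise t \<omega>)"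
  define V where "V = (\<Sum>t=1..T. grad_variation grad X Dist t \<omega>)"
  define W where "W = (\<Sum>t=1..T. \<eta> t \<omega> * \<Delta> t \<omega>)"
  have T: "T \<in> {1..T}" using horizon by simp
  note \<eta> = step_size_pos[OF \<omega>] step_size_mono[OF \<omega>] step_size_inverse_ge[OF \<omega>]
  have nonneg: "P \<ge> 0" "E \<ge> 0" "V \<ge> 0"
    unfolding P_def E_def V_def
    by (auto intro!: sum_nonneg grad_variation_bounds \<omega> simp: noise_def)
  have regret: "(\<Sum>t=1..T. g t \<omega> \<bullet> (x t \<omega> - u)) \<le> (norm u)\<^sup>2 / \<eta> T \<omega> + W / 2
     - (\<Sum>t\<in>{1..<T}. (norm (x (Suc t) \<omega> - x t \<omega>))\<^sup>2 / (2 * \<eta> t \<omega>))"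
    unfolding W_def
    by (rule oftrl_regret[OF domain(2,3) horizon comparator _ \<eta>(1,2) iterates[OF _ \<omega>]])
      (simp_all add: obs_grad_def)
  have "(norm u)\<^sup>2 / \<eta> T \<omega> \<le> D\<^sup>2 / \<eta> T \<omega>"
    using diameter[OF comparator zero_in] \<eta>(1)[OF T] by (intro divide_right_mono power_mono) auto
  also have "\<dots> = \<delta> + (\<Sum>s\<in>{1..<T}. \<eta> s \<omega> * \<Delta> s \<omega>)"
    using step_size_eq[OF T \<omega>] \<eta>(1)[OF T] pos by (simp add: field_simps)
  also have "\<dots> \<le> \<delta> + W"
    unfolding W_def using \<eta>(1)[THEN less_imp_le]
    by (intro add_left_mono sum_mono2 mult_nonneg_nonneg zero_le_power2) auto
  finally have first: "(norm u)\<^sup>2 / \<eta> T \<omega> \<le> \<delta> + W" .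
  have moves: "\<delta> / (2 * D\<^sup>2) * P \<le> (\<Sum>t\<in>{1..<T}. (norm (x (Suc t) \<omega> - x t \<omega>))\<^sup>2 / (2 * \<eta> t \<omega>))"
    unfolding P_def sum_distrib_left
  proof (rule sum_mono)
    fix t assume "t \<in> {1..<T}"
    then have "\<delta> / D\<^sup>2 \<le> 1 / \<eta> t \<omega>" by (intro \<eta>(3)) auto
    then have "\<delta> / D\<^sup>2 * ((norm (x (Suc t) \<omega> - x t \<omega>))\<^sup>2 / 2) \<le> 1 / \<eta> t \<omega> * ((norm (x (Suc t) \<omega> - x t \<omega>))\<^sup>2 / 2)"
      by (rule mult_right_mono) simp
    then show "\<delta> / (2 * D\<^sup>2) * (norm (x (Suc t) \<omega> - x t \<omega>))\<^sup>2 \<le> (norm (x (Suc t) \<omega> - x t \<omega>))\<^sup>2 / (2 * \<eta> t \<omega>)"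
      by (simp add: mult.commute)
  qed
  have "(\<Sum>t=1..T. \<Delta> t \<omega>) \<le> 8 * E + 4 * V + 4 * L\<^sup>2 * P"
    using sum_gradient_differences_le[OF \<omega>] by (simp only: E_def V_def P_def)
  \<comment> \<open>\<open>8 * E\<close> is relaxed to \<open>9 * E\<close>, so that the square
    roots get the coefficients 3, 2 and \<open>2 * L\<close>; the cross terms are
    nonnegative.\<close>
  also have "\<dots> \<le> (3 * sqrt E + 2 * sqrt V + 2 * L * sqrt P)\<^sup>2"
  proof -
    have "(3 * sqrt E + 2 * sqrt V + 2 * L * sqrt P)\<^sup>2 = 9 * (sqrt E)\<^sup>2 + 4 * (sqrt V)\<^sup>2 + 4 * L\<^sup>2 * (sqrt P)\<^sup>2
        + (12 * (sqrt E * sqrt V) + 12 * (L * (sqrt E * sqrt P)) + 8 * (L * (sqrt V * sqrt P)))"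
      by (simp only: power2_eq_square) algebra
    moreover have "0 \<le> 12 * (sqrt E * sqrt V) + 12 * (L * (sqrt E * sqrt P)) + 8 * (L * (sqrt V * sqrt P))"
      using nonneg pos by (intro add_nonneg_nonneg mult_nonneg_nonneg) auto
    ultimately show ?thesis using nonneg by simp
  qed
  finally have "sqrt (\<Sum>t=1..T. \<Delta> t \<omega>) \<le> 3 * sqrt E + 2 * sqrt V + 2 * L * sqrt P"
    by (rule real_le_lsqrt[rotated]) (use nonneg pos in simp)
  then have "5 / 3 * D * sqrt (\<Sum>t=1..T. \<Delta> t \<omega>) \<le> 5 / 3 * D * (3 * sqrt E + 2 * sqrt V + 2 * L * sqrt P)"
    using pos by (intro mult_left_mono) auto
  then have W: "W \<le> 5 * (D * sqrt E) + 10 / 3 * (D * sqrt V) + 10 / 3 * (D * L * sqrt P)"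
    using step_size_sum_le[OF \<omega>] unfolding W_def by (simp add: algebra_simps)
  \<comment> \<open>The left side is \<open>3 / 2\<close> times the move term in the bound on
    \<open>W\<close>. Completing the square in \<open>sqrt P\<close> trades it for the available
    moves and a constant.\<close>
  have absorb: "5 * (D * L * sqrt P) \<le> \<delta> / (2 * D\<^sup>2) * P + 25 / 2 * (D^4 * L\<^sup>2 / \<delta>)"
  proof -
    have "0 \<le> (\<delta> * sqrt P - 5 * D^3 * L)\<^sup>2 / (2 * D\<^sup>2 * \<delta>)"
      using delta_pos by simp
    also have "\<dots> = \<delta> / (2 * D\<^sup>2) * (sqrt P)\<^sup>2 + 25 / 2 * (D^4 * L\<^sup>2 / \<delta>) - 5 * (D * L * sqrt P)"
      using delta_pos pos by (simp only: power2_diff) (simp add: field_simps power_def)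
    finally show ?thesis using nonneg by simp
  qed
  from regret first moves W absorb show ?thesis
    unfolding E_def[symmetric] V_def[symmetric] mult.assoc by linarith
qed

text \<open>Iterates are given only as pointwise minimisers, so measurability is derived: step sizes
  are formulas in earlier gradients, and iterates are projections of such formulas. The induction
  stays inside one \<open>H t\<close>, as the model does not ask the histories to be nested.\<close>

lemma iterate_measurable:
  assumes t: "t \<in> {1..T}"
  shows "s \<in> {1..t} \<Longrightarrow> x s \<in> borel_measurable (H t) \<and> \<eta> s \<in> borel_measurable (H t)"
proof (induction s rule: less_induct)
  case (less s)
  then have s: "s \<in> {1..T}" using t by auto
  have gm: "g r \<in> borel_measurable (H t)" if r: "r < s" for r
  proof (cases "r = 0")
    case True
    then have "g r = (\<lambda>_. 0)" by (simp add: obs_grad_def fun_eq_iff)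
    then show ?thesis by simp
  next
    case False
    then have r': "r \<in> {1..t}" "r \<in> {1..<t}" "r \<in> {1..T}" using r less.prems t by auto
    have "x r \<in> H t \<rightarrow>\<^sub>M restrict_space borel X"
      using less.IH[OF r r'(1)] iterate_in[OF r'(3)] space_history[OF t]
      by (intro measurable_restrict_space2) auto
    then have "(\<lambda>\<omega>. (f r \<omega>, x r \<omega>)) \<in> H t \<rightarrow>\<^sub>M N \<Otimes>\<^sub>M restrict_space borel X"
      by (rule measurable_Pair[OF past_functions[OF t r'(2)]])
    from measurable_compose[OF this grad_measurable] False show ?thesis
      by (simp add: obs_grad_def[abs_def])
  qed
  have "(\<lambda>\<omega>. D\<^sup>2 / (\<delta> + (\<Sum>r\<in>{1..<s}. \<eta> r \<omega> * \<Delta> r \<omega>))) \<in> borel_measurable (H t)"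
    using less.prems
    by (intro borel_measurable_divide borel_measurable_add borel_measurable_const borel_measurable_sum
        borel_measurable_times borel_measurable_power measurable_compose[OF _ borel_measurable_norm]
        borel_measurable_diff gm
        less.IH[THEN conjunct2]) auto
  then have \<eta>: "\<eta> s \<in> borel_measurable (H t)"
    using step_size_eq[OF s] space_history[OF t] by (subst measurable_cong) auto
  \<comment> \<open>The unconstrained minimiser of the objective of round \<open>s\<close>, in the
    form produced by \<open>is_arg_min_quadratic\<close> with
    \<open>c = 1 / \<eta> s \<omega>\<close>.\<close>
  let ?p = "\<lambda>\<omega>. - (1 / (2 * (1 / \<eta> s \<omega>))) *\<^sub>R ((\<Sum>r\<in>{1..<s}. g r \<omega>) + g (s - 1) \<omega>)"
  have p: "?p \<in> borel_measurable (H t)"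
    using \<eta> less.prems
    by (intro borel_measurable_scaleR borel_measurable_uminus borel_measurable_divide
        borel_measurable_add borel_measurable_times borel_measurable_const borel_measurable_sum gm) auto
  have "closest_point X \<in> borel_measurable borel"
    using continuous_on_closest_point[OF domain(3,2,1)] by (rule borel_measurable_continuous_onI)
  from measurable_compose[OF p this]
  have "(\<lambda>\<omega>. closest_point X (?p \<omega>)) \<in> borel_measurable (H t)" .
  moreover have "x s \<omega> = closest_point X (?p \<omega>)" if "\<omega> \<in> space (H t)" for \<omega>
  proof -
    have \<omega>: "\<omega> \<in> space M" using that space_history[OF t] by simp
    then have "1 / \<eta> s \<omega> > 0" using step_size_pos s by simp
    from is_arg_min_quadratic(1)[OF domain(2,3) this iterates[OF s \<omega>, unfolded oftrl_objective_alt]]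
    show ?thesis .
  qed
  ultimately have "x s \<in> borel_measurable (H t)"
    by (subst measurable_cong) auto
  with \<eta> show ?case by simp
qed

section \<open>One round in expectation, conditioned on its history\<close>

context
  fixes t assumes t: "t \<in> {1..T}"
begin

lemma expectation_given_history:
  fixes \<phi> :: "'w \<Rightarrow> ('a \<Rightarrow> real) \<Rightarrow> real"
  assumes "(\<lambda>(\<omega>, h). \<phi> \<omega> h) \<in> borel_measurable (H t \<Otimes>\<^sub>M N)"
    and "\<And>\<omega> h. \<omega> \<in> space M \<Longrightarrow> h \<in> space N \<Longrightarrow> \<bar>\<phi> \<omega> h\<bar> \<le> B"
  shows "integrable M (\<lambda>\<omega>. \<phi> \<omega> (f t \<omega>))"
    and "integrable M (\<lambda>\<omega>. \<integral>h. \<phi> \<omega> h \<partial>Dist t \<omega>)"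
    and "(\<integral>\<omega>. \<phi> \<omega> (f t \<omega>) \<partial>M) = (\<integral>\<omega>. (\<integral>h. \<phi> \<omega> h \<partial>Dist t \<omega>) \<partial>M)"
proof -
  have "Dist t \<in> H t \<rightarrow>\<^sub>M prob_algebra N" using t by (intro distributions) auto
  note * = expectation_conditional_law[OF history[OF t] sampled[OF t] this conditional_law[OF t] assms]
  show "integrable M (\<lambda>\<omega>. \<phi> \<omega> (f t \<omega>))" by (rule *(1))
  show "integrable M (\<lambda>\<omega>. \<integral>h. \<phi> \<omega> h \<partial>Dist t \<omega>)" by (rule *(2))
  show "(\<integral>\<omega>. \<phi> \<omega> (f t \<omega>) \<partial>M) = (\<integral>\<omega>. (\<integral>h. \<phi> \<omega> h \<partial>Dist t \<omega>) \<partial>M)" by (rule *(3))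
qed

lemma iterate_measurable_history: "x t \<in> borel_measurable (H t)"
  using iterate_measurable[OF t, of t] t by auto

lemma pair_iterate_measurable:
  "(\<lambda>(\<omega>, h). (h, x t \<omega>)) \<in> H t \<Otimes>\<^sub>M N \<rightarrow>\<^sub>M N \<Otimes>\<^sub>M restrict_space borel X"
proof -
  have "x t \<in> H t \<rightarrow>\<^sub>M restrict_space borel X"
    using iterate_measurable_history iterate_in[OF t] space_history[OF t]
    by (intro measurable_restrict_space2) auto
  from measurable_compose[OF measurable_fst this] show ?thesis
    unfolding case_prod_beta by (intro measurable_Pair) auto
qed

lemma grad_iterate_measurable:
  "(\<lambda>(\<omega>, h). grad h (x t \<omega>)) \<in> borel_measurable (H t \<Otimes>\<^sub>M N)"
  using measurable_compose[OF pair_iterate_measurable grad_measurable] by (simp add: case_prod_beta)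

lemma exp_grad_iterate_measurable:
  "(\<lambda>\<omega>. exp_grad grad (Dist t \<omega>) (x t \<omega>)) \<in> borel_measurable (H t)"
  unfolding exp_grad_def by (rule integral_measurable_kernel[OF grad_iterate_measurable kernel[OF t]])

text \<open>Individual functions need not be convex, so linearisation is justified only after
  averaging: with the history frozen, both sides become quantities of the expected function, and its
  first-order inequality applies.\<close>

lemma expected_linear_regret_round:
  shows "integrable M (\<lambda>\<omega>. f t \<omega> (x t \<omega>) - f t \<omega> u)"
    and "integrable M (\<lambda>\<omega>. g t \<omega> \<bullet> (x t \<omega> - u))"
    and "(\<integral>\<omega>. f t \<omega> (x t \<omega>) - f t \<omega> u \<partial>M) \<le> (\<integral>\<omega>. g t \<omega> \<bullet> (x t \<omega> - u) \<partial>M)"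
proof -
  have g: "g t \<omega> = grad (f t \<omega>) (x t \<omega>)" for \<omega> using t by (simp add: obs_grad_def)
  have "(\<lambda>(\<omega>, h). h (x t \<omega>)) \<in> borel_measurable (H t \<Otimes>\<^sub>M N)"
    using measurable_compose[OF pair_iterate_measurable eval_measurable] by (simp add: case_prod_beta)
  moreover have "(\<lambda>(\<omega>, h). h u) \<in> borel_measurable (H t \<Otimes>\<^sub>M N)"
  proof -
    have "(\<lambda>(\<omega>, h). (h, u)) \<in> H t \<Otimes>\<^sub>M N \<rightarrow>\<^sub>M N \<Otimes>\<^sub>M restrict_space borel X"
      unfolding case_prod_beta using comparator
      by (intro measurable_Pair) (auto simp: space_restrict_space)
    from measurable_compose[OF this eval_measurable] show ?thesis by (simp add: case_prod_beta)
  qed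
  ultimately have m1: "(\<lambda>(\<omega>, h). h (x t \<omega>) - h u) \<in> borel_measurable (H t \<Otimes>\<^sub>M N)"
    unfolding case_prod_beta by (rule borel_measurable_diff)
  \<comment> \<open>No uniform bound on function values is available, but differences are bounded by
    the mean value inequality; hence the two losses are integrated together.\<close>
  have b1: "\<bar>h (x t \<omega>) - h u\<bar> \<le> G * D" if \<omega>: "\<omega> \<in> space M" and h: "h \<in> space N" for \<omega> h
  proof -
    have "norm (h (x t \<omega>) - h u) \<le> G * norm (x t \<omega> - u)"
    proof (rule differentiable_bound[OF domain(3) differentiable[OF h]])
      fix y assume y: "y \<in> X"
      show "onorm (\<lambda>v. grad h y \<bullet> v) \<le> G"
      proof (rule onorm_le)
        fix v
        have "norm (grad h y \<bullet> v) \<le> norm (grad h y) * norm v"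
          using Cauchy_Schwarz_ineq2 by simp
        also have "\<dots> \<le> G * norm v" using grad_bound[OF h y] by (intro mult_right_mono) auto
        finally show "norm (grad h y \<bullet> v) \<le> G * norm v" .
      qed
    qed (use comparator iterate_in[OF t \<omega>] in auto)
    also have "\<dots> \<le> G * D"
      using pos diameter[OF iterate_in[OF t \<omega>] comparator] by (intro mult_left_mono) auto
    finally show ?thesis by simp
  qed
  have "(\<lambda>(\<omega>, h). x t \<omega> - u) \<in> borel_measurable (H t \<Otimes>\<^sub>M N)"
    using measurable_compose[OF measurable_fst iterate_measurable_history]
    unfolding case_prod_beta by (intro borel_measurable_diff) auto
  with grad_iterate_measurable
  have m2: "(\<lambda>(\<omega>, h). grad h (x t \<omega>) \<bullet> (x t \<omega> - u)) \<in> borel_measurable (H t \<Otimes>\<^sub>M N)"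
    unfolding case_prod_beta by (rule borel_measurable_inner)
  have b2: "\<bar>grad h (x t \<omega>) \<bullet> (x t \<omega> - u)\<bar> \<le> G * D" if \<omega>: "\<omega> \<in> space M" and h: "h \<in> space N" for \<omega> h
  proof -
    have "\<bar>grad h (x t \<omega>) \<bullet> (x t \<omega> - u)\<bar> \<le> norm (grad h (x t \<omega>)) * norm (x t \<omega> - u)"
      by (rule Cauchy_Schwarz_ineq2)
    also have "\<dots> \<le> G * D"
      using pos h diameter[OF iterate_in[OF t \<omega>] comparator] iterate_in[OF t \<omega>]
      by (intro mult_mono grad_bound) auto
    finally show ?thesis .
  qed
  note e1 = expectation_given_history[OF m1 b1] and e2 = expectation_given_history[OF m2 b2]
  show "integrable M (\<lambda>\<omega>. f t \<omega> (x t \<omega>) - f t \<omega> u)" by (rule e1(1))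
  show "integrable M (\<lambda>\<omega>. g t \<omega> \<bullet> (x t \<omega> - u))" unfolding g by (rule e2(1))
  have int1: "integrable M (\<lambda>\<omega>. \<integral>h. h (x t \<omega>) - h u \<partial>Dist t \<omega>)" by (rule e1(2))
  have int2: "integrable M (\<lambda>\<omega>. \<integral>h. grad h (x t \<omega>) \<bullet> (x t \<omega> - u) \<partial>Dist t \<omega>)" by (rule e2(2))
  have "(\<integral>h. h (x t \<omega>) - h u \<partial>Dist t \<omega>) \<le> (\<integral>h. grad h (x t \<omega>) \<bullet> (x t \<omega> - u) \<partial>Dist t \<omega>)"
    if \<omega>: "\<omega> \<in> space M" for \<omega>
  proof -
    note xX = iterate_in[OF t \<omega>]
    have "(\<integral>h. h (x t \<omega>) - h u \<partial>Dist t \<omega>) = exp_fun (Dist t \<omega>) (x t \<omega>) - exp_fun (Dist t \<omega>) u"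
      unfolding exp_fun_def
      by (intro Bochner_Integration.integral_diff exp_fun_integrable t \<omega> xX comparator)
    also have "\<dots> \<le> exp_grad grad (Dist t \<omega>) (x t \<omega>) \<bullet> (x t \<omega> - u)"
      by (rule convex_on_gradient_le[OF convex_exp[OF t \<omega>] interchange[OF t \<omega> xX] xX comparator])
    also have "\<dots> = (\<integral>h. grad h (x t \<omega>) \<bullet> (x t \<omega> - u) \<partial>Dist t \<omega>)"
      unfolding exp_grad_def using grad_integrable[OF t \<omega> xX] by simp
    finally show ?thesis .
  qed
  then have "(\<integral>\<omega>. (\<integral>h. h (x t \<omega>) - h u \<partial>Dist t \<omega>) \<partial>M)
      \<le> (\<integral>\<omega>. (\<integral>h. grad h (x t \<omega>) \<bullet> (x t \<omega> - u) \<partial>Dist t \<omega>) \<partial>M)"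
    by (rule integral_mono[OF int1 int2])
  with e1(3) e2(3)
  show "(\<integral>\<omega>. f t \<omega> (x t \<omega>) - f t \<omega> u \<partial>M) \<le> (\<integral>\<omega>. g t \<omega> \<bullet> (x t \<omega> - u) \<partial>M)"
    unfolding g by linarith
qed

lemma noise_bounds:
  assumes "\<omega> \<in> space M"
  shows "0 \<le> noise t \<omega>" "noise t \<omega> \<le> 4 * G\<^sup>2"
  using assms t unfolding noise_def
  by (auto intro!: norm_diff_squared_bound grad_bound exp_grad_bound iterate_in sampled_in)

text \<open>With the history frozen, the inner integral is the variance at the point
  \<open>x t \<omega>\<close> of \<open>X\<close>, which lies below the supremum.\<close>

lemma expected_noise_le:
  shows "integrable M (noise t)"
    and "(\<integral>\<omega>. noise t \<omega> \<partial>M) \<le> (\<integral>\<omega>. grad_variance grad X (Dist t \<omega>) \<partial>M)"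
proof -
  let ?\<phi> = "\<lambda>\<omega> h. (norm (grad h (x t \<omega>) - exp_grad grad (Dist t \<omega>) (x t \<omega>)))\<^sup>2"
  have "(\<lambda>(\<omega>, h). exp_grad grad (Dist t \<omega>) (x t \<omega>)) \<in> borel_measurable (H t \<Otimes>\<^sub>M N)"
    using measurable_compose[OF measurable_fst exp_grad_iterate_measurable]
    unfolding case_prod_beta .
  with grad_iterate_measurable have m: "(\<lambda>(\<omega>, h). ?\<phi> \<omega> h) \<in> borel_measurable (H t \<Otimes>\<^sub>M N)"
    unfolding case_prod_beta
    by (intro borel_measurable_power measurable_compose[OF _ borel_measurable_norm] borel_measurable_diff)
  have b: "\<bar>?\<phi> \<omega> h\<bar> \<le> 4 * G\<^sup>2" if "\<omega> \<in> space M" "h \<in> space N" for \<omega> h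
    using that t by (auto intro!: norm_diff_squared_bound grad_bound exp_grad_bound iterate_in)
  note e = expectation_given_history[OF m b]
  show "integrable M (noise t)" using e(1) by (simp add: noise_def[abs_def])
  have "integrable M (\<lambda>\<omega>. grad_variance grad X (Dist t \<omega>))"
    using grad_variance_bounds[OF t] variance_measurable[OF t]
    by (intro integrable_const_bound[of _ "4 * G\<^sup>2"]) auto
  then show "(\<integral>\<omega>. noise t \<omega> \<partial>M) \<le> (\<integral>\<omega>. grad_variance grad X (Dist t \<omega>) \<partial>M)"
    using integral_mono[OF e(2) _ grad_variance_ge[OF t _ iterate_in[OF t]]] e(3)
    by (simp add: noise_def)
qed

end

section \<open>Summation over the rounds and the final constant\<close>

lemma expected_regret:
  "(\<integral>\<omega>. (\<Sum>t=1..T. f t \<omega> (x t \<omega>)) - (\<Sum>t=1..T. f t \<omega> u) \<partial>M) \<le> \<delta> + 25 / 2 * (D^4 * L\<^sup>2 / \<delta>)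
      + 15 / 2 * D * sqrt (sigma_sq_total M grad X Dist T) + 5 * D * sqrt (Sigma_sq_total M grad X Dist T)"
proof -
  let ?E = "\<lambda>\<omega>. \<Sum>t=1..T. noise t \<omega>" and ?V = "\<lambda>\<omega>. \<Sum>t=1..T. grad_variation grad X Dist t \<omega>"
  \<comment> \<open>These crude bounds in \<open>T\<close> serve integrability only and do not enter
    the result.\<close>
  have E_bounds: "0 \<le> ?E \<omega> \<and> ?E \<omega> \<le> real T * (4 * G\<^sup>2)" if "\<omega> \<in> space M" for \<omega>
    using noise_bounds[OF _ that] sum_bounded_above[of "{1..T}" "\<lambda>t. noise t \<omega>" "4 * G\<^sup>2"]
    by (auto intro!: sum_nonneg)
  have V_bounds: "0 \<le> ?V \<omega> \<and> ?V \<omega> \<le> real T * (4 * G\<^sup>2)" if "\<omega> \<in> space M" for \<omega>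
    using grad_variation_bounds[OF _ that]
      sum_bounded_above[of "{1..T}" "\<lambda>t. grad_variation grad X Dist t \<omega>" "4 * G\<^sup>2"]
    by (auto intro!: sum_nonneg)
  have "?E \<in> borel_measurable M"
    by (intro borel_measurable_sum borel_measurable_integrable expected_noise_le(1))
  note E = expectation_sqrt_le[OF this E_bounds]
  have "?V \<in> borel_measurable M"
    by (intro borel_measurable_sum variation_measurable)
  note V = expectation_sqrt_le[OF this V_bounds]
  have "(\<integral>\<omega>. ?E \<omega> \<partial>M) = (\<Sum>t=1..T. \<integral>\<omega>. noise t \<omega> \<partial>M)"
    by (intro Bochner_Integration.integral_sum expected_noise_le(1))
  also have "\<dots> \<le> (\<Sum>t=1..T. \<integral>\<omega>. grad_variance grad X (Dist t \<omega>) \<partial>M)"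
    by (intro sum_mono expected_noise_le(2))
  also have "\<dots> = sigma_sq_total M grad X Dist T"
    unfolding sigma_sq_total_def
    using grad_variance_bounds variance_measurable
    by (intro Bochner_Integration.integral_sum[symmetric] integrable_const_bound[of _ "4 * G\<^sup>2"]) auto
  finally have "sqrt (\<integral>\<omega>. ?E \<omega> \<partial>M) \<le> sqrt (sigma_sq_total M grad X Dist T)"
    by (rule real_sqrt_le_mono)
  from order_trans[OF E(3) this] have \<sigma>: "15 / 2 * D * (\<integral>\<omega>. sqrt (?E \<omega>) \<partial>M) \<le> 15 / 2 * D * sqrt (sigma_sq_total M grad X Dist T)"
    using pos by (intro mult_left_mono) auto
  have \<Sigma>: "5 * D * (\<integral>\<omega>. sqrt (?V \<omega>) \<partial>M) \<le> 5 * D * sqrt (Sigma_sq_total M grad X Dist T)"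
    using V(3) pos unfolding Sigma_sq_total_def by (intro mult_left_mono) auto
  have "(\<integral>\<omega>. (\<Sum>t=1..T. f t \<omega> (x t \<omega>)) - (\<Sum>t=1..T. f t \<omega> u) \<partial>M)
      = (\<Sum>t=1..T. \<integral>\<omega>. f t \<omega> (x t \<omega>) - f t \<omega> u \<partial>M)"
    unfolding sum_subtractf[symmetric]
    by (intro Bochner_Integration.integral_sum expected_linear_regret_round(1))
  also have "\<dots> \<le> (\<Sum>t=1..T. \<integral>\<omega>. g t \<omega> \<bullet> (x t \<omega> - u) \<partial>M)"
    by (intro sum_mono expected_linear_regret_round(3))
  also have "\<dots> = (\<integral>\<omega>. (\<Sum>t=1..T. g t \<omega> \<bullet> (x t \<omega> - u)) \<partial>M)"
    by (intro Bochner_Integration.integral_sum[symmetric] expected_linear_regret_round(2))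
  also have "\<dots> \<le> (\<integral>\<omega>. \<delta> + 25 / 2 * (D^4 * L\<^sup>2 / \<delta>)
      + 15 / 2 * D * sqrt (?E \<omega>) + 5 * D * sqrt (?V \<omega>) \<partial>M)"
    by (intro integral_mono pathwise_regret Bochner_Integration.integrable_sum
        expected_linear_regret_round(2) Bochner_Integration.integrable_add integrable_mult_right
        E(2) V(2) integrable_const)
  also have "\<dots> = \<delta> + 25 / 2 * (D^4 * L\<^sup>2 / \<delta>)
      + 15 / 2 * D * (\<integral>\<omega>. sqrt (?E \<omega>) \<partial>M) + 5 * D * (\<integral>\<omega>. sqrt (?V \<omega>) \<partial>M)"
    using E(2) V(2) by (simp add: prob_space)
  finally show ?thesis using \<sigma> \<Sigma> by linarith
qed

lemma expected_regret_le_const: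
  "(\<integral>\<omega>. (\<Sum>t=1..T. f t \<omega> (x t \<omega>)) - (\<Sum>t=1..T. f t \<omega> u) \<partial>M)
    \<le> oftrl_const D G L * (1 + sqrt (sigma_sq_total M grad X Dist T) + sqrt (Sigma_sq_total M grad X Dist T))"
proof -
  let ?C = "oftrl_const D G L"
  have "0 \<le> sigma_sq_total M grad X Dist T" "0 \<le> Sigma_sq_total M grad X Dist T"
    unfolding sigma_sq_total_def Sigma_sq_total_def
    by (auto intro!: integral_nonneg_AE AE_I2 sum_nonneg grad_variance_bounds grad_variation_bounds)
  moreover have q: "0 \<le> D^4 * L\<^sup>2 / \<delta>" using delta_pos by simp
  \<comment> \<open>The factor 20 exceeds 1, \<open>25 / 2\<close>, \<open>15 / 2\<close> and 5, and
    all three summands of \<open>oftrl_const\<close> are nonnegative.\<close>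
  have "15 / 2 * D \<le> ?C" "5 * D \<le> ?C" and c: "\<delta> + 25 / 2 * (D^4 * L\<^sup>2 / \<delta>) \<le> ?C"
    unfolding oftrl_const_def using delta_pos pos q by (simp_all only: distrib_left)
  ultimately have "15 / 2 * D * sqrt (sigma_sq_total M grad X Dist T) \<le> ?C * sqrt (sigma_sq_total M grad X Dist T)"
    "5 * D * sqrt (Sigma_sq_total M grad X Dist T) \<le> ?C * sqrt (Sigma_sq_total M grad X Dist T)"
    by - (intro mult_right_mono real_sqrt_ge_zero; assumption)+
  then show ?thesis
    using expected_regret c by (simp add: distrib_left)
qed

end

theorem theorem2:
  fixes M :: "'w measure"
    and X :: "'a::euclidean_space set"
    and T :: nat
    and N :: "('a \<Rightarrow> real) measure"
    and grad :: "('a \<Rightarrow> real) \<Rightarrow> 'a \<Rightarrow> 'a"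
    and H :: "nat \<Rightarrow> 'w measure"
    and Dist :: "nat \<Rightarrow> 'w \<Rightarrow> ('a \<Rightarrow> real) measure"
    and f :: "nat \<Rightarrow> 'w \<Rightarrow> 'a \<Rightarrow> real"
    and x :: "nat \<Rightarrow> 'w \<Rightarrow> 'a"
    and \<eta> :: "nat \<Rightarrow> 'w \<Rightarrow> real"
    and D G L :: real
    and u :: 'a
  assumes model: "sea_model M X T N grad H Dist f"
    and pos: "G > 0" "D > 0" "L > 0"
    and grad_bound: "\<And>h y. h \<in> space N \<Longrightarrow> y \<in> X \<Longrightarrow> norm (grad h y) \<le> G"
    and zero_in: "0 \<in> X"
    and diameter: "\<And>y z. y \<in> X \<Longrightarrow> z \<in> X \<Longrightarrow> norm (y - z) \<le> D"
    and smooth: "\<And>t \<omega> y z. t \<in> {1..T} \<Longrightarrow> \<omega> \<in> space M \<Longrightarrow> y \<in> X \<Longrightarrow> z \<in> X \<Longrightarrow>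
        norm (exp_grad grad (Dist t \<omega>) y - exp_grad grad (Dist t \<omega>) z) \<le> L * norm (y - z)"
    and convex_exp: "\<And>t \<omega>. t \<in> {1..T} \<Longrightarrow> \<omega> \<in> space M \<Longrightarrow> convex_on X (exp_fun (Dist t \<omega>))"
    and step_size: "\<And>t \<omega>. t \<in> {1..T} \<Longrightarrow> \<omega> \<in> space M \<Longrightarrow>
        oftrl_step D (oftrl_delta D G L) (\<lambda>s. obs_grad grad f x s \<omega>) (\<lambda>s. \<eta> s \<omega>) t"
    and iterates: "\<And>t \<omega>. t \<in> {1..T} \<Longrightarrow> \<omega> \<in> space M \<Longrightarrow>
        is_arg_min (oftrl_objective (\<lambda>s. obs_grad grad f x s \<omega>) (\<lambda>s. \<eta> s \<omega>) (\<lambda>s. x s \<omega>) t)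
          (\<lambda>y. y \<in> X) (x t \<omega>)"
    and comparator: "u \<in> X"
  shows "(\<integral>\<omega>. (\<Sum>t=1..T. f t \<omega> (x t \<omega>)) - (\<Sum>t=1..T. f t \<omega> u) \<partial>M)
      \<le> oftrl_const D G L *
          (1 + sqrt (sigma_sq_total M grad X Dist T) + sqrt (Sigma_sq_total M grad X Dist T))"
proof -
  have "sea_oftrl M X T N grad H Dist f x \<eta> D G L u"
    by (intro sea_oftrl.intro sea_oftrl_axioms.intro model) (fact assms)+
  then show ?thesis
    by (rule sea_oftrl.expected_regret_le_const)
qed

end
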